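(* Let $M$ be any one of the following: (1) the matrix monoid $\mathbb{N}^{3\times3}$; (2) the direct product of free monoids $\{0,1\}^*\times\{0,1\}^*$; (3) the direct product of free groups $\mathrm{FG}_2\times\mathrm{FG}_2$. Then the freeness problem for finitely generated subsemigroups of $M$ is undecidable: there is no algorithm which, given a finite set $S\subseteq M$, decides whether the subsemigroup $\langle S\rangle$ of $M$ generated by $S$ is free over $S$. Moreover, the number of generators can be kept bounded without changing undecidability: there is a constant $K$ such that the problem remains undecidable when restricted to inputs $S$ with $|S|\le K$.
   Context: $\mathbb{N}^{3\times3}$ is the monoid of $3\times3$ matrices over the natural numbers (including $0$) under matrix multiplication; $\{0,1\}^*$ is the free monoid of finite binary strings; $\mathrm{FG}_2$ is the free group on two generators. $\langle S\rangle$ denotes the subsemigroup generated by $S$ (in case (3) also the subsemigroup, not the subgroup). $\langle S\rangle$ is free over $S$ if every element of $\langle S\rangle$ has a unique expression as a product of a finite non-empty sequence of elements of $S$ (this is not the same as asking whether $\langle S\rangle$ is isomorphic to some free semigroup). *)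

theory Defs
  imports
    "HOL-Algebra.Group"
    "HOL-Analysis.Cartesian_Space"
    "HOL-Library.Nat_Bijection"
begin

section \<open>Algorithms: partial recursive functions\<close>

text \<open>
  Kleene's partial recursive functions, presented as programs \<open>r\<close> together with their evaluation
  relation: \<open>rec_eval r xs y\<close> says that the computation of \<open>r\<close> on the arguments \<open>xs\<close> halts with
  value \<open>y\<close>. Arities are left implicit: restricted to the argument lists of any one length, each
  program computes a partial recursive function of that many arguments. In \<open>Prec\<close> the recursion
  variable, and in \<open>Mu\<close> the search variable, is the first argument; \<open>Mu\<close> requires the searched
  function to be defined on all arguments below the result.
\<close>

datatype recprog =
    Zero
  | Succ
  | Proj nat
  | Comp recprog "recprog list"
  | Prec recprog recprog
  | Mu recprog

inductive rec_eval :: "recprog \<Rightarrow> nat list \<Rightarrow> nat \<Rightarrow> bool" where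
  eval_Zero: "rec_eval Zero xs 0"
| eval_Succ: "rec_eval Succ [x] (Suc x)"
| eval_Proj: "i < length xs \<Longrightarrow> rec_eval (Proj i) xs (xs ! i)"
| eval_Comp: "list_all2 (\<lambda>g y. rec_eval g xs y) gs ys \<Longrightarrow> rec_eval f ys z
    \<Longrightarrow> rec_eval (Comp f gs) xs z"
| eval_Prec_0: "rec_eval f xs z \<Longrightarrow> rec_eval (Prec f g) (0 # xs) z"
| eval_Prec_Suc: "rec_eval (Prec f g) (n # xs) y \<Longrightarrow> rec_eval g (n # y # xs) z
    \<Longrightarrow> rec_eval (Prec f g) (Suc n # xs) z"
| eval_Mu: "rec_eval f (n # xs) 0 \<Longrightarrow> \<forall>k<n. \<exists>y. rec_eval f (k # xs) (Suc y)
    \<Longrightarrow> rec_eval (Mu f) xs n"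

lemma rec_eval_deterministic:
  "rec_eval r xs y \<Longrightarrow> rec_eval r xs z \<Longrightarrow> y = z"
proof (induction arbitrary: z rule: rec_eval.induct)
  case (eval_Zero xs)
  then show ?case by cases simp
next
  case (eval_Succ x)
  then show ?case by cases simp
next
  case (eval_Proj i xs)
  from eval_Proj.prems show ?case by cases simp
next
  case (eval_Prec_0 f xs w g)
  from eval_Prec_0.prems have "rec_eval f xs z" by cases
  with eval_Prec_0.IH show ?case by blast
next
  case (eval_Comp xs gs ys f w)
  from eval_Comp.prems obtain ys' where ys': "list_all2 (\<lambda>g y. rec_eval g xs y) gs ys'"
    and z: "rec_eval f ys' z"
    by cases
  have "ys = ys'"
    using eval_Comp.IH(1) ys' by (auto simp: list_all2_conv_all_nth list_eq_iff_nth_eq)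
  with eval_Comp.IH(2) z show ?case by blast
next
  case (eval_Prec_Suc f g n xs y w)
  from eval_Prec_Suc.prems obtain y' where "rec_eval (Prec f g) (n # xs) y'"
    and "rec_eval g (n # y' # xs) z"
    by cases
  with eval_Prec_Suc.IH show ?case by blast
next
  case (eval_Mu f n xs)
  from eval_Mu.prems have 0: "rec_eval f (z # xs) 0"
    by cases
  from eval_Mu.prems have pos: "\<forall>k<z. \<exists>y. rec_eval f (k # xs) (Suc y)"
    by cases
  show ?case
  proof (rule linorder_cases[of n z])
    assume "n < z"
    with pos eval_Mu.IH(1) show ?thesis by blast
  next
    assume "z < n"
    with 0 eval_Mu.IH(2) show ?thesis by blast
  qed
qed

text \<open>
  Decidability of the property \<open>P\<close> for instances drawn from \<open>I\<close>, where the algorithm receives the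
  instance \<open>x\<close> as the number \<open>code x\<close>. Nothing is required of the algorithm on numbers that do not
  encode an instance in \<open>I\<close>.
\<close>

definition decidable_on :: "('i \<Rightarrow> nat) \<Rightarrow> 'i set \<Rightarrow> ('i \<Rightarrow> bool) \<Rightarrow> bool" where
  "decidable_on code I P \<longleftrightarrow>
     (\<exists>r. \<forall>x\<in>I. rec_eval r [code x] (if P x then 1 else 0))"

section \<open>Freeness\<close>

inductive_set subsemigroup_gen :: "('a, 'b) monoid_scheme \<Rightarrow> 'a set \<Rightarrow> 'a set"
  for M (structure) and S where
  gen: "s \<in> S \<Longrightarrow> s \<in> subsemigroup_gen M S"
| mult: "x \<in> subsemigroup_gen M S \<Longrightarrow> y \<in> subsemigroup_gen M S
    \<Longrightarrow> x \<otimes> y \<in> subsemigroup_gen M S"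

definition list_product :: "('a, 'b) monoid_scheme \<Rightarrow> 'a list \<Rightarrow> 'a" where
  "list_product M ws = foldr (\<otimes>\<^bsub>M\<^esub>) ws \<one>\<^bsub>M\<^esub>"

definition free_over :: "('a, 'b) monoid_scheme \<Rightarrow> 'a set \<Rightarrow> bool" where
  "free_over M S \<longleftrightarrow>
     (\<forall>x\<in>subsemigroup_gen M S. \<exists>!ws. ws \<noteq> [] \<and> set ws \<subseteq> S \<and> list_product M ws = x)"

section \<open>The freeness problem\<close>

text \<open>
  Given an encoding of the elements of \<open>M\<close>, a finite set is presented by its canonical index, the
  sum of the powers of two whose exponents are the codes of its elements.
\<close>

definition finset_code :: "('a \<Rightarrow> nat) \<Rightarrow> 'a set \<Rightarrow> nat" where
  "finset_code enc S = set_encode (enc ` S)"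

definition freeness_decidable :: "('a, 'b) monoid_scheme \<Rightarrow> ('a \<Rightarrow> nat) \<Rightarrow> bool" where
  "freeness_decidable M enc \<longleftrightarrow>
     decidable_on (finset_code enc) (Fpow (carrier M)) (free_over M)"

definition bounded_freeness_decidable ::
    "('a, 'b) monoid_scheme \<Rightarrow> ('a \<Rightarrow> nat) \<Rightarrow> nat \<Rightarrow> bool" where
  "bounded_freeness_decidable M enc K \<longleftrightarrow>
     decidable_on (finset_code enc) {S \<in> Fpow (carrier M). card S \<le> K} (free_over M)"

lemma inj_on_finset_code:
  assumes "inj_on enc A"
  shows "inj_on (finset_code enc) (Fpow A)"
proof (rule inj_onI)
  fix S T assume S: "S \<in> Fpow A" and T: "T \<in> Fpow A" and eq: "finset_code enc S = finset_code enc T"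
  from S T have "finite S" "finite T" "S \<subseteq> A" "T \<subseteq> A" by (auto simp: Fpow_def)
  with eq have "enc ` S = enc ` T" by (simp add: finset_code_def set_encode_eq)
  with \<open>S \<subseteq> A\<close> \<open>T \<subseteq> A\<close> assms show "S = T" by (simp add: inj_on_image_eq_iff)
qed

section \<open>Matrices over the natural numbers\<close>

definition nat_mat3 :: "(nat ^ 3 ^ 3) monoid" where
  "nat_mat3 = \<lparr>carrier = UNIV, mult = (**), one = mat 1\<rparr>"

definition nat_mat3_code :: "nat ^ 3 ^ 3 \<Rightarrow> nat" where
  "nat_mat3_code A = list_encode
     [A $ 1 $ 1, A $ 1 $ 2, A $ 1 $ 3,
      A $ 2 $ 1, A $ 2 $ 2, A $ 2 $ 3,
      A $ 3 $ 1, A $ 3 $ 2, A $ 3 $ 3]"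

lemma monoid_nat_mat3: "Group.monoid nat_mat3"
  by unfold_locales
    (auto simp: nat_mat3_def matrix_mul_assoc simp del: One_nat_def)

lemma inj_nat_mat3_code: "inj nat_mat3_code"
proof (rule injI)
  fix A B :: "nat ^ 3 ^ 3" assume "nat_mat3_code A = nat_mat3_code B"
  then have "\<forall>i\<in>{1, 2, 3}. \<forall>j\<in>{1, 2, 3}. A $ i $ j = B $ i $ j"
    unfolding nat_mat3_code_def list_encode_eq by simp
  then show "A = B" by (simp add: vec_eq_iff forall_3)
qed

section \<open>Pairs of binary words\<close>

definition free_monoid :: "'a list monoid" where
  "free_monoid = \<lparr>carrier = UNIV, mult = (@), one = []\<rparr>"

definition binary_words2 :: "(bool list \<times> bool list) monoid" where
  "binary_words2 = free_monoid \<times>\<times> free_monoid"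

definition word_code :: "('a \<Rightarrow> nat) \<Rightarrow> 'a list \<Rightarrow> nat" where
  "word_code enc w = list_encode (map enc w)"

definition pair_code :: "('a \<Rightarrow> nat) \<Rightarrow> ('b \<Rightarrow> nat) \<Rightarrow> 'a \<times> 'b \<Rightarrow> nat" where
  "pair_code enc1 enc2 p = prod_encode (enc1 (fst p), enc2 (snd p))"

definition binary_words2_code :: "bool list \<times> bool list \<Rightarrow> nat" where
  "binary_words2_code = pair_code (word_code of_bool) (word_code of_bool)"

lemma monoid_free_monoid: "Group.monoid free_monoid"
  by unfold_locales (auto simp: free_monoid_def)

lemma monoid_binary_words2: "Group.monoid binary_words2"
  unfolding binary_words2_def by (intro DirProd_monoid monoid_free_monoid)

lemma inj_word_code: "inj enc \<Longrightarrow> inj (word_code enc)"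
  by (auto intro!: injI simp: word_code_def list_encode_eq inj_map_eq_map)

lemma inj_pair_code: "inj enc1 \<Longrightarrow> inj enc2 \<Longrightarrow> inj (pair_code enc1 enc2)"
  by (auto intro!: injI simp: pair_code_def prod_encode_eq prod_eq_iff inj_eq)

lemma inj_of_bool: "inj (of_bool :: bool \<Rightarrow> nat)"
  by (rule injI) (auto simp: of_bool_def split: if_splits)

lemma inj_binary_words2_code: "inj binary_words2_code"
  unfolding binary_words2_code_def by (intro inj_pair_code inj_word_code inj_of_bool)

section \<open>Pairs of elements of the free group on two generators\<close>

text \<open>
  The letter \<open>(False, a)\<close> is the generator \<open>a\<close>, and \<open>(True, a)\<close> is its inverse. The elements of the
  free group are the reduced words, and multiplication is concatenation followed by cancellation.
\<close>

definition letter_inv :: "bool \<times> 'a \<Rightarrow> bool \<times> 'a" where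
  "letter_inv l = (\<not> fst l, snd l)"

definition reduced :: "(bool \<times> 'a) list \<Rightarrow> bool" where
  "reduced w \<longleftrightarrow> successively (\<lambda>l l'. l' \<noteq> letter_inv l) w"

fun push_letter :: "bool \<times> 'a \<Rightarrow> (bool \<times> 'a) list \<Rightarrow> (bool \<times> 'a) list" where
  "push_letter l [] = [l]"
| "push_letter l (l' # w) = (if l' = letter_inv l then w else l # l' # w)"

definition reduced_mult ::
    "(bool \<times> 'a) list \<Rightarrow> (bool \<times> 'a) list \<Rightarrow> (bool \<times> 'a) list" where
  "reduced_mult v w = foldr push_letter v w"

definition free_group :: "(bool \<times> 'a) list monoid" where
  "free_group = \<lparr>carrier = {w. reduced w}, mult = reduced_mult, one = []\<rparr>"

type_synonym fg2 = "(bool \<times> bool) list"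

text \<open>The two generators are indexed by \<^typ>\<open>bool\<close>.\<close>

definition FG2 :: "fg2 monoid" where
  "FG2 = free_group"

definition FG2_squared :: "(fg2 \<times> fg2) monoid" where
  "FG2_squared = FG2 \<times>\<times> FG2"

definition FG2_code :: "fg2 \<Rightarrow> nat" where
  "FG2_code = word_code (pair_code of_bool of_bool)"

definition FG2_squared_code :: "fg2 \<times> fg2 \<Rightarrow> nat" where
  "FG2_squared_code = pair_code FG2_code FG2_code"

lemma inj_FG2_squared_code: "inj FG2_squared_code"
  unfolding FG2_squared_code_def FG2_code_def
  by (intro inj_pair_code inj_word_code inj_of_bool)

lemma letter_inv_inv [simp]: "letter_inv (letter_inv l) = l"
  by (simp add: letter_inv_def)

lemma reduced_Nil [simp]: "reduced []"
  by (simp add: reduced_def)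

lemma reduced_Cons:
  "reduced (l # w) \<longleftrightarrow> reduced w \<and> (w \<noteq> [] \<longrightarrow> hd w \<noteq> letter_inv l)"
  by (cases w) (auto simp: reduced_def)

lemma reduced_push_letter: "reduced w \<Longrightarrow> reduced (push_letter l w)"
  by (cases w) (auto simp: reduced_Cons)

lemma push_letter_inv: "reduced w \<Longrightarrow> push_letter l (push_letter (letter_inv l) w) = w"
proof (cases w)
  case (Cons l' v)
  assume "reduced w"
  with Cons show ?thesis by (cases v) (auto simp: reduced_Cons)
qed simp

lemma push_letter_reduced: "reduced (l # w) \<Longrightarrow> push_letter l w = l # w"
  by (cases w) (auto simp: reduced_Cons)

lemma reduced_reduced_mult: "reduced w \<Longrightarrow> reduced (reduced_mult v w)"
  by (induction v) (auto simp: reduced_mult_def reduced_push_letter)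

lemma reduced_mult_push_letter:
  assumes "reduced w"
  shows "reduced_mult (push_letter l v) w = push_letter l (reduced_mult v w)"
proof (cases v)
  case (Cons l' u)
  then show ?thesis
    using push_letter_inv[OF reduced_reduced_mult[OF assms]] by (auto simp: reduced_mult_def)
qed (simp add: reduced_mult_def)

lemma reduced_mult_assoc:
  "reduced w \<Longrightarrow> reduced_mult (reduced_mult u v) w = reduced_mult u (reduced_mult v w)"
proof (induction u)
  case Nil
  show ?case by (simp add: reduced_mult_def)
next
  case (Cons l u)
  have "reduced_mult (reduced_mult (l # u) v) w = reduced_mult (push_letter l (reduced_mult u v)) w"
    by (simp add: reduced_mult_def)
  also have "\<dots> = push_letter l (reduced_mult u (reduced_mult v w))"
    using Cons by (simp add: reduced_mult_push_letter)
  finally show ?case by (simp add: reduced_mult_def)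
qed

lemma reduced_mult_Nil_right: "reduced w \<Longrightarrow> reduced_mult w [] = w"
  by (induction w) (auto simp: reduced_mult_def reduced_Cons push_letter_reduced)

lemma reduced_inverse: "reduced w \<Longrightarrow> reduced (map letter_inv (rev w))"
  unfolding reduced_def successively_map successively_rev
  by (erule successively_mono) auto

lemma reduced_mult_inverse: "reduced_mult (map letter_inv (rev w)) w = []"
  by (induction w) (auto simp: reduced_mult_def)

lemma group_free_group: "group free_group"
proof (rule groupI)
  fix w :: "(bool \<times> 'a) list" assume "w \<in> carrier free_group"
  then show "\<exists>v\<in>carrier free_group. v \<otimes>\<^bsub>free_group\<^esub> w = \<one>\<^bsub>free_group\<^esub>"
    by (auto simp: free_group_def intro!: bexI[of _ "map letter_inv (rev w)"]
        reduced_mult_inverse reduced_inverse)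
qed (auto simp: free_group_def reduced_reduced_mult reduced_mult_assoc,
     auto simp: reduced_mult_def)

lemma group_FG2_squared: "group FG2_squared"
  unfolding FG2_squared_def FG2_def by (intro DirProd_group group_free_group)

end

theory Submission
  imports Defs
begin

text \<open>
  Two facts are combined. First, one fixed string rewriting system can interpret all partial
  recursive programs: its words carry the text of a loop program together with a tape of unary
  registers, and exactly one letter is active at any time, so that rewriting is deterministic. A
  diagonal argument then shows that reachability of the halting word is undecidable. Second,
  reachability in a fixed system is turned into ambiguity of products of pairs of words. As in
  Post's correspondence problem, a derivation is a solution of
  \<open>w @ r\<^sub>1 @ \<dots> @ r\<^sub>n = l\<^sub>1 @ \<dots> @ l\<^sub>n @ z\<close>; each tile gives two generators with the same first
  component, and the second components \<open>a#b#\<close> and \<open>#a#b\<close> are shifted against each other, so that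
  two factorizations of the same element can only differ by spelling out the two sides of such an
  equation. Only the generator containing the initial word depends on the input, which bounds the
  number of generators.
\<close>

section \<open>Computable functions\<close>

text \<open>The simulation has to be correct for halting computations only: it is applied to a
  supposed decider, which is total, so nothing is proved about diverging programs. The answer 1
  leads into \<open>FAIL\<close>, a stuck word, and determinism turns this into unreachability of
  \<open>[Halt]\<close>. A bound on the number of generators requires rules that are fixed once and
  for all; this is why the program is part of the rewritten word instead of being translated into
  rules. Since algorithms act on numbers, the map from \<open>x\<close> to the code of the
  generating set must itself be computable; as a single generator varies, this comes down to folding
  computable functions over one word (\<open>foldable\<close>). Freeness depends only on which
  products coincide, so each of the three monoids enters merely through an injective homomorphism
  from pairs of binary words (\<open>word_pair_embedding\<close>): positive words for the free
  groups, a pair of affine maps for the matrices.\<close>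

definition computable :: "nat \<Rightarrow> (nat list \<Rightarrow> nat) \<Rightarrow> bool" where
  "computable k F \<longleftrightarrow> (\<exists>r. \<forall>xs. length xs = k \<longrightarrow> rec_eval r xs (F xs))"

lemma computable_cong:
  "computable k F \<Longrightarrow> (\<And>xs. length xs = k \<Longrightarrow> F xs = G xs) \<Longrightarrow> computable k G"
  unfolding computable_def by metis

lemma computable_nth: "i < k \<Longrightarrow> computable k (\<lambda>xs. xs ! i)"
  unfolding computable_def by (metis eval_Proj)

lemma computable_apply:
  assumes "computable (length Gs) F" "\<And>G. G \<in> set Gs \<Longrightarrow> computable k G"
  shows "computable k (\<lambda>xs. F (map (\<lambda>G. G xs) Gs))"
proof -
  obtain f where f: "\<And>xs. length xs = length Gs \<Longrightarrow> rec_eval f xs (F xs)"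
    using assms(1) unfolding computable_def by blast
  obtain g where g: "\<And>G xs. G \<in> set Gs \<Longrightarrow> length xs = k \<Longrightarrow> rec_eval (g G) xs (G xs)"
    using assms(2) unfolding computable_def by metis
  have "rec_eval (Comp f (map g Gs)) xs (F (map (\<lambda>G. G xs) Gs))" if "length xs = k" for xs
    by (rule eval_Comp[OF _ f]) (auto simp: list_all2_conv_all_nth intro: g that)
  then show ?thesis
    unfolding computable_def by blast
qed

lemma computable_apply1:
  "computable (Suc 0) F \<Longrightarrow> computable k G \<Longrightarrow> computable k (\<lambda>xs. F [G xs])"
  using computable_apply[of "[G]" F k] by auto

lemma computable_apply2:
  "computable 2 F \<Longrightarrow> computable k G \<Longrightarrow> computable k H \<Longrightarrow> computable k (\<lambda>xs. F [G xs, H xs])"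
  using computable_apply[of "[G, H]" F k] by (auto simp: numeral_2_eq_2)

lemma computable_Suc: "computable k G \<Longrightarrow> computable k (\<lambda>xs. Suc (G xs))"
proof -
  have "computable (Suc 0) (\<lambda>xs. Suc (xs ! 0))"
    unfolding computable_def by (rule exI[of _ Succ]) (auto simp: length_Suc_conv intro: eval_Succ)
  then show "computable k G \<Longrightarrow> computable k (\<lambda>xs. Suc (G xs))"
    by (drule_tac computable_apply1) auto
qed

lemma computable_const: "computable k (\<lambda>_. c)"
proof (induction c)
  case 0
  show ?case unfolding computable_def using eval_Zero by blast
next
  case (Suc c)
  then show ?case by (rule computable_Suc)
qed

lemma computable_rec:
  assumes "computable k Z" "computable (Suc (Suc k)) G"
  shows "computable (Suc k) (\<lambda>xs. rec_nat (Z (tl xs)) (\<lambda>n y. G (n # y # tl xs)) (hd xs))"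
proof -
  obtain f where f: "\<And>xs. length xs = k \<Longrightarrow> rec_eval f xs (Z xs)"
    using assms(1) unfolding computable_def by blast
  obtain g where g: "\<And>xs. length xs = Suc (Suc k) \<Longrightarrow> rec_eval g xs (G xs)"
    using assms(2) unfolding computable_def by blast
  have "rec_eval (Prec f g) (n # xs) (rec_nat (Z xs) (\<lambda>n y. G (n # y # xs)) n)"
    if "length xs = k" for n xs
    by (induction n) (auto intro!: eval_Prec_0 eval_Prec_Suc f g that)
  then have "rec_eval (Prec f g) xs (rec_nat (Z (tl xs)) (\<lambda>n y. G (n # y # tl xs)) (hd xs))"
    if "length xs = Suc k" for xs
    using that by (cases xs) auto
  then show ?thesis
    unfolding computable_def by blast
qed


abbreviation computable1 :: "(nat \<Rightarrow> nat) \<Rightarrow> bool" where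
  "computable1 f \<equiv> computable (Suc 0) (\<lambda>xs. f (xs ! 0))"

lemma computable1_comp: "computable1 f \<Longrightarrow> computable k G \<Longrightarrow> computable k (\<lambda>xs. f (G xs))"
  using computable_apply1[of "\<lambda>xs. f (xs ! 0)" k G] by simp

lemma computable1_rec:
  assumes "computable 2 (\<lambda>xs. g (xs ! 0) (xs ! 1))" "\<And>n. f (Suc n) = g n (f n)"
  shows "computable1 f"
proof -
  have rec: "rec_nat (f 0) (\<lambda>n y. g n y) n = f n" for n
    by (induction n) (auto simp: assms(2))
  have "computable (Suc 0) (\<lambda>xs. rec_nat (f 0) (\<lambda>n y. g ((n # y # tl xs) ! 0) ((n # y # tl xs) ! 1)) (hd xs))"
    using assms(1) by (intro computable_rec computable_const) (simp add: numeral_2_eq_2)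
  then show ?thesis
    by (rule computable_cong) (auto simp: rec length_Suc_conv)
qed

lemma computable_add:
  assumes "computable k G" "computable k H"
  shows "computable k (\<lambda>xs. G xs + H xs)"
proof -
  have rec: "rec_nat a (\<lambda>n y. Suc y) n = n + a" for a n :: nat
    by (induction n) auto
  have "computable (Suc (Suc 0))
      (\<lambda>xs. rec_nat ((tl xs) ! 0) (\<lambda>n y. Suc ((n # y # tl xs) ! 1)) (hd xs))"
    by (rule computable_rec[of "Suc 0"]) (auto intro!: computable_nth computable_Suc)
  then have "computable (Suc (Suc 0)) (\<lambda>xs. xs ! 0 + xs ! 1)"
    by (rule computable_cong) (auto simp: rec length_Suc_conv)
  then have "computable 2 (\<lambda>xs. xs ! 0 + xs ! 1)"
    by (simp only: numeral_2_eq_2)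
  from computable_apply2[OF this assms] show ?thesis
    by simp
qed

lemma computable_if_zero:
  assumes "computable k G" "computable k A" "computable k B"
  shows "computable k (\<lambda>xs. if G xs = 0 then A xs else B xs)"
proof -
  \<comment> \<open>The recursion step ignores the recursive value: index 3 of
    \<open>n # y # tl xs\<close> is the third argument, the value for a nonzero test.\<close>
  have "computable (Suc (Suc (Suc 0)))
      (\<lambda>xs. rec_nat ((tl xs) ! 0) (\<lambda>n y. (n # y # tl xs) ! 3) (hd xs))"
    by (rule computable_rec[of "Suc (Suc 0)"]) (auto intro!: computable_nth)
  then have "computable (Suc (Suc (Suc 0))) (\<lambda>xs. if xs ! 0 = 0 then xs ! 1 else xs ! 2)"
    by (rule computable_cong) (auto simp: length_Suc_conv gr0_conv_Suc numeral_eq_Suc)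
  then show ?thesis
    using computable_apply[of "[G, A, B]" "\<lambda>xs. if xs ! 0 = 0 then xs ! 1 else xs ! 2" k] assms
    by (auto simp: numeral_2_eq_2 cong: if_cong)
qed

lemma computable1_pred: "computable1 (\<lambda>n. n - 1)"
  by (rule computable1_rec[of "\<lambda>n y. n"]) (auto intro!: computable_nth)

text \<open>The functions \<open>H a\<close> need no common program: as \<open>G\<close> stays below
  \<open>b\<close>, nested zero tests select among finitely many programs.\<close>

lemma computable_finite_cases:
  assumes "computable k G" "\<And>xs. G xs < b" "\<And>a. computable k (H a)"
  shows "computable k (\<lambda>xs. H (G xs) xs)"
  using assms
proof (induction b arbitrary: G H)
  case (Suc b)
  show ?case
  proof (cases b)
    case 0
    with Suc.prems show ?thesis by simp
  next
    case (Suc c)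
    have "computable k (\<lambda>xs. H (Suc (G xs - 1)) xs)"
      using Suc.prems computable1_comp[OF computable1_pred]
      by (intro Suc.IH[of "\<lambda>xs. G xs - 1" "\<lambda>n. H (Suc n)"])
        (auto simp: less_diff_conv2 Suc less_Suc_eq_le le_diff_conv intro: order.trans)
    from computable_if_zero[OF Suc.prems(1,3) this, of 0] show ?thesis
      by (rule computable_cong) auto
  qed
qed simp

lemma computable1_diff: "computable1 (\<lambda>n. c - n)"
  by (rule computable1_rec[of "\<lambda>n y. y - 1", OF computable1_comp[OF computable1_pred]])
    (auto intro!: computable_nth)

lemma computable1_mod:
  assumes "0 < b"
  shows "computable1 (\<lambda>n. n mod b)"
proof (rule computable1_rec)
  \<comment> \<open>The remainder counts up and wraps at \<open>b - 1\<close>; as it never exceeds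
    \<open>b - 1\<close>, the truncated difference vanishes exactly at the wrap.\<close>
  show "computable 2 (\<lambda>xs. if (b - 1) - xs ! 1 = 0 then 0 else Suc (xs ! 1))"
    by (intro computable_if_zero computable_const computable_Suc computable_nth
        computable1_comp[OF computable1_diff]) auto
  show "Suc n mod b = (if (b - 1) - n mod b = 0 then 0 else Suc (n mod b))" for n
    using mod_less_divisor[OF assms, of n] by (auto simp: mod_Suc simp del: mod_less_divisor)
qed

lemma computable1_div:
  assumes "0 < b"
  shows "computable1 (\<lambda>n. n div b)"
proof (rule computable1_rec)
  show "computable 2 (\<lambda>xs. if Suc (xs ! 0) mod b = 0 then Suc (xs ! 1) else xs ! 1)"
    by (intro computable_if_zero computable_Suc computable_nth
        computable1_comp[OF computable1_mod[OF assms]]) auto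
qed (simp add: div_Suc)

lemma computable1_power2: "computable1 (\<lambda>n. 2 ^ n)"
  by (rule computable1_rec[of "\<lambda>n y. y + y"]) (auto intro!: computable_add computable_nth)

lemma computable_prod_encode:
  assumes "computable k G" "computable k H"
  shows "computable k (\<lambda>xs. prod_encode (G xs, H xs))"
proof -
  have triangle: "computable1 triangle"
    by (rule computable1_rec[of "\<lambda>n y. y + Suc n"])
      (auto intro!: computable_add computable_nth computable_Suc)
  then show ?thesis
    unfolding prod_encode_def prod.case
    by (intro computable_add computable1_comp[OF triangle] assms)
qed

lemma computable_list_encode_Cons:
  assumes "computable k G" "computable k (\<lambda>xs. list_encode (H xs))"
  shows "computable k (\<lambda>xs. list_encode (G xs # H xs))"
  unfolding list_encode.simps by (rule computable_Suc[OF computable_prod_encode[OF assms]])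

section \<open>Computable families of words\<close>

text \<open>No coding of words is chosen: a word-valued function counts as computable if all folds
  with computable letter actions are. The encodings used for the three monoids are such folds, and
  the varying start value \<open>z\<close> is what makes appending possible.\<close>

definition foldable :: "(nat \<Rightarrow> 'a list) \<Rightarrow> bool" where
  "foldable W \<longleftrightarrow> (\<forall>c z. (\<forall>a. computable1 (c a)) \<longrightarrow> computable1 z \<longrightarrow>
     computable1 (\<lambda>x. foldr c (W x) (z x)))"

lemma foldableD:
  "foldable W \<Longrightarrow> (\<And>a. computable1 (c a)) \<Longrightarrow> computable1 z \<Longrightarrow> computable1 (\<lambda>x. foldr c (W x) (z x))"
  by (simp add: foldable_def)

lemma foldable_append:
  assumes "foldable V" "foldable W"
  shows "foldable (\<lambda>x. V x @ W x)"
  unfolding foldable_def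
proof (intro allI impI)
  fix c :: "'a \<Rightarrow> nat \<Rightarrow> nat" and z assume c: "\<forall>a. computable1 (c a)" and z: "computable1 z"
  show "computable1 (\<lambda>x. foldr c (V x @ W x) (z x))"
    using foldableD[OF assms(1) spec[OF c] foldableD[OF assms(2) spec[OF c] z]] by simp
qed

lemma computable1_foldr: "(\<And>a. computable1 (c a)) \<Longrightarrow> computable1 (foldr c w)"
proof (induction w)
  case (Cons a w)
  then show ?case using computable1_comp[of "c a" "Suc 0" "\<lambda>xs. foldr c w (xs ! 0)"] by simp
qed (auto intro: computable_nth)

lemma foldable_const: "foldable (\<lambda>_. w)"
  unfolding foldable_def using computable1_comp[OF computable1_foldr] by blast

lemma foldable_concat_map:
  fixes W :: "nat \<Rightarrow> 'a list" and h :: "'a \<Rightarrow> 'b list"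
  assumes "foldable W"
  shows "foldable (\<lambda>x. concat (map h (W x)))"
  unfolding foldable_def
proof (intro allI impI)
  fix c :: "'b \<Rightarrow> nat \<Rightarrow> nat" and z assume "\<forall>a. computable1 (c a)" "computable1 z"
  then have "computable1 (\<lambda>x. foldr (\<lambda>a. foldr c (h a)) (W x) (z x))"
    by (intro foldableD[OF assms] computable1_foldr) auto
  moreover have "foldr c (concat (map h w)) z = foldr (\<lambda>a. foldr c (h a)) w z" for w z
    by (induction w) auto
  ultimately show "computable1 (\<lambda>x. foldr c (concat (map h (W x))) (z x))"
    by simp
qed

lemma foldable_map: "foldable W \<Longrightarrow> foldable (\<lambda>x. map h (W x))"
  using foldable_concat_map[of W "\<lambda>a. [h a]"] by simp

text \<open>Bounding the length by the argument itself saves a second parameter in applications.\<close>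

lemma foldable_digits:
  assumes "0 < b"
  shows "foldable (\<lambda>x. map (\<lambda>i. x div b ^ i mod b) (rev [0..<x]))"
  unfolding foldable_def
proof (intro allI impI)
  fix c :: "nat \<Rightarrow> nat \<Rightarrow> nat" and z assume c: "\<forall>a. computable1 (c a)" and z: "computable1 z"
  let ?step = "\<lambda>xs. (c (xs ! 2 div b ^ (xs ! 0) mod b)) (xs ! 1)"
  have quot: "rec_nat x (\<lambda>_ y. y div b) n = x div b ^ n" for x n
    by (induction n) (auto simp: div_mult2_eq[symmetric] mult.commute)
  have "computable (Suc (Suc 0)) (\<lambda>xs. rec_nat ((tl xs) ! 0) (\<lambda>n y. ((n # y # tl xs) ! 1) div b) (hd xs))"
    by (rule computable_rec[of "Suc 0"])
      (auto intro!: computable_nth computable1_comp[OF computable1_div] assms)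
  then have "computable (Suc (Suc 0)) (\<lambda>xs. xs ! 1 div b ^ (xs ! 0))"
    by (rule computable_cong) (auto simp: quot length_Suc_conv)
  then have "computable 2 (\<lambda>xs. xs ! 1 div b ^ (xs ! 0))"
    by (simp only: numeral_2_eq_2)
  from computable_apply2[OF this computable_nth[of 0] computable_nth[of 2]]
  have "computable (Suc (Suc (Suc 0))) (\<lambda>xs. xs ! 2 div b ^ (xs ! 0))"
    by simp
  from computable1_comp[OF computable1_mod[OF assms] this]
  have digit: "computable (Suc (Suc (Suc 0))) (\<lambda>xs. xs ! 2 div b ^ (xs ! 0) mod b)" .
  have "computable (Suc (Suc (Suc 0))) (\<lambda>xs. c a (xs ! 1))" for a
    using computable1_comp[OF spec[OF c] computable_nth] by simp
  from computable_finite_cases[OF digit mod_less_divisor[OF assms] this]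
  have "computable (Suc (Suc (Suc 0))) ?step" .
  then have rec: "computable (Suc (Suc 0))
      (\<lambda>xs. rec_nat (z (tl xs ! 0)) (\<lambda>n y. ?step (n # y # tl xs)) (hd xs))"
    by (rule computable_rec[OF z])
  \<comment> \<open>\<open>rev [0..<Suc n]\<close> begins with \<open>n\<close>, so each round of
    the recursion applies the action of the next more significant digit outermost.\<close>
  have eq: "rec_nat (z x) (\<lambda>n y. ?step (n # y # [x])) n
      = foldr c (map (\<lambda>i. x div b ^ i mod b) (rev [0..<n])) (z x)" for n x
    by (induction n) auto
  have "computable 2 (\<lambda>xs. foldr c (map (\<lambda>i. xs ! 1 div b ^ i mod b) (rev [0..<xs ! 0])) (z (xs ! 1)))"
    unfolding numeral_2_eq_2
  proof (rule computable_cong[OF rec])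
    fix xs :: "nat list" assume "length xs = Suc (Suc 0)"
    then obtain n x where "xs = [n, x]"
      by (auto simp: length_Suc_conv)
    with eq[of x n] show "rec_nat (z (tl xs ! 0)) (\<lambda>n y. ?step (n # y # tl xs)) (hd xs)
        = foldr c (map (\<lambda>i. xs ! 1 div b ^ i mod b) (rev [0..<xs ! 0])) (z (xs ! 1))"
      by simp
  qed
  from computable_apply2[OF this computable_nth computable_nth, of 0 "Suc 0" 0]
  show "computable1 (\<lambda>x. foldr c (map (\<lambda>i. x div b ^ i mod b) (rev [0..<x])) (z x))"
    by simp
qed

text \<open>Only the length of the digit list matters: each of the \<open>x\<close> binary digits is
  replaced by \<open>a\<close>.\<close>

lemma foldable_replicate: "foldable (\<lambda>x. replicate x a)"
proof -
  have "concat (map (\<lambda>_. [a]) (map (\<lambda>i. x div 2 ^ i mod 2) (rev [0..<x]))) = replicate x a" for x :: nat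
    by (simp add: map_replicate_const o_def concat_map_singleton)
  then show ?thesis
    using foldable_concat_map[OF foldable_digits[of 2], of "\<lambda>_. [a]"] by simp
qed

section \<open>Compilation to loop programs\<close>

text \<open>\<open>FAIL\<close> has no rule in \<open>exec\<close>; it serves to get the simulation
  stuck.\<close>

datatype com = SKIP | INC nat | SEQ com com | LOOP nat com | FAIL

text \<open>\<open>LOOP i c\<close> decrements the register \<open>i\<close> before each execution of \<open>c\<close>.\<close>

inductive exec :: "com \<Rightarrow> (nat \<Rightarrow> nat) \<Rightarrow> (nat \<Rightarrow> nat) \<Rightarrow> bool" where
  exec_SKIP: "exec SKIP s s"
| exec_INC: "exec (INC i) s (s(i := Suc (s i)))"
| exec_SEQ: "exec c s s' \<Longrightarrow> exec d s' s'' \<Longrightarrow> exec (SEQ c d) s s''"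
| exec_LOOP_0: "s i = 0 \<Longrightarrow> exec (LOOP i c) s s"
| exec_LOOP_Suc: "0 < s i \<Longrightarrow> exec c (s(i := s i - 1)) s' \<Longrightarrow> exec (LOOP i c) s' s''
    \<Longrightarrow> exec (LOOP i c) s s''"

inductive_cases exec_SEQ_E: "exec (SEQ c d) s s'"

definition CLEAR :: "nat \<Rightarrow> com" where
  "CLEAR d = LOOP d SKIP"

lemma exec_CLEAR: "exec (CLEAR d) s (s(d := 0))"
proof (induction "s d" arbitrary: s)
  case 0
  then have "s(d := 0) = s"
    by auto
  with exec_LOOP_0[of s d SKIP] 0 show ?case
    by (simp add: CLEAR_def)
next
  case (Suc n)
  then show ?case
    using exec_LOOP_Suc[of s d SKIP "s(d := s d - 1)" "s(d := 0)"] Suc.hyps(1)[of "s(d := s d - 1)"]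
    by (auto simp: CLEAR_def exec_SKIP)
qed

text \<open>Reading a register destroys it, as loops count down; hence the detour through
  \<open>t\<close>, from which \<open>a\<close> is refilled.\<close>

definition COPY :: "nat \<Rightarrow> nat \<Rightarrow> nat \<Rightarrow> com" where
  "COPY a d t = SEQ (CLEAR d) (SEQ (CLEAR t)
     (SEQ (LOOP a (SEQ (INC d) (INC t))) (LOOP t (INC a))))"

lemma exec_COPY:
  assumes "a \<noteq> d" "a \<noteq> t" "d \<noteq> t"
  shows "exec (COPY a d t) s (s(d := s a, t := 0))"
proof -
  have 1: "exec (LOOP a (SEQ (INC d) (INC t))) s (s(a := 0, d := s d + s a, t := s t + s a))" for s
    using assms
  proof (induction "s a" arbitrary: s)
    case 0
    then have eq: "s(a := 0, d := s d + s a, t := s t + s a) = s"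
      by auto
    show ?case
      unfolding eq by (rule exec_LOOP_0) (simp add: 0)
  next
    case (Suc n)
    let ?s = "s(a := s a - 1, d := Suc (s d), t := Suc (s t))"
    have "exec (SEQ (INC d) (INC t)) (s(a := s a - 1)) ?s"
      using Suc.prems exec_SEQ[OF exec_INC exec_INC, of d t "s(a := s a - 1)"] by auto
    moreover have "exec (LOOP a (SEQ (INC d) (INC t))) ?s (s(a := 0, d := s d + s a, t := s t + s a))"
    proof -
      have "?s(a := 0, d := ?s d + ?s a, t := ?s t + ?s a) = s(a := 0, d := s d + s a, t := s t + s a)"
        using Suc.prems Suc.hyps(2) by (auto simp: fun_eq_iff)
      with Suc.hyps(1)[of ?s] Suc.hyps(2) Suc.prems show ?thesis by auto
    qed
    ultimately show ?case
      using Suc.hyps(2) exec_LOOP_Suc by (metis zero_less_Suc)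
  qed
  have 2: "exec (LOOP t (INC a)) s (s(t := 0, a := s a + s t))" for s
    using assms
  proof (induction "s t" arbitrary: s)
    case 0
    then have eq: "s(t := 0, a := s a + s t) = s"
      by auto
    show ?case
      unfolding eq by (rule exec_LOOP_0) (simp add: 0)
  next
    case (Suc n)
    let ?s = "s(t := s t - 1, a := Suc (s a))"
    have "exec (INC a) (s(t := s t - 1)) ?s"
      using Suc.prems exec_INC[of a "s(t := s t - 1)"] by auto
    moreover have "exec (LOOP t (INC a)) ?s (s(t := 0, a := s a + s t))"
    proof -
      have "?s(t := 0, a := ?s a + ?s t) = s(t := 0, a := s a + s t)"
        using Suc.prems Suc.hyps(2) by (auto simp: fun_eq_iff)
      with Suc.hyps(1)[of ?s] Suc.hyps(2) Suc.prems show ?thesis by auto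
    qed
    ultimately show ?case
      using Suc.hyps(2) exec_LOOP_Suc by (metis zero_less_Suc)
  qed
  let ?s = "s(d := 0, t := 0)"
  have "exec (COPY a d t) s (let r = ?s(a := 0, d := ?s d + ?s a, t := ?s t + ?s a) in r(t := 0, a := r a + r t))"
    unfolding COPY_def Let_def
    by (rule exec_SEQ[OF exec_CLEAR exec_SEQ[OF exec_CLEAR exec_SEQ[OF 1 2]]])
  also have "(let r = ?s(a := 0, d := ?s d + ?s a, t := ?s t + ?s a) in r(t := 0, a := r a + r t))
      = s(d := s a, t := 0)"
    using assms by (auto simp: Let_def fun_eq_iff)
  finally show ?thesis .
qed

text \<open>
  \<open>compile r as d b\<close> computes \<open>r\<close> on the contents of the registers \<open>as\<close> into register \<open>d\<close>, using the
  registers from \<open>b\<close> on as scratch space with arbitrary initial contents.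
\<close>

function (sequential) compile :: "recprog \<Rightarrow> nat list \<Rightarrow> nat \<Rightarrow> nat \<Rightarrow> com" where
  "compile Zero as d b = CLEAR d"
| "compile Succ as d b = SEQ (COPY (hd as) d b) (INC d)"
| "compile (Proj i) as d b = COPY (as ! i) d b"
| "compile (Comp f gs) as d b =
     (let m = length gs in
      SEQ (foldr SEQ (map (\<lambda>(g, j). compile g as (b + j) (b + m)) (zip gs [0..<m])) SKIP)
        (compile f [b..<b + m] d (b + m)))"
| "compile (Prec f g) as d b =
     SEQ (COPY (hd as) b (b + 1)) (SEQ (CLEAR (b + 1)) (SEQ (compile f (tl as) (b + 2) (b + 3))
       (SEQ (LOOP b (SEQ (compile g ((b + 1) # (b + 2) # tl as) (b + 3) (b + 4))
          (SEQ (COPY (b + 3) (b + 2) (b + 4)) (INC (b + 1)))))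
        (COPY (b + 2) d b))))"
| "compile (Mu f) as d b =
     SEQ (CLEAR b) (SEQ (compile f (b # as) (b + 1) (b + 2))
       (SEQ (LOOP (b + 1) (SEQ (INC b) (compile f (b # as) (b + 1) (b + 2))))
         (COPY b d (b + 1))))"
  by pat_completeness auto
termination
proof (relation "measure (\<lambda>(r, _). size r)", goal_cases)
  case (2 f gs as d b m p g j)
  then have "g \<in> set gs"
    by (auto dest: set_zip_leftD)
  then have "size g \<le> size_list size gs"
    by (simp add: size_list_estimation')
  then show ?case by simp
qed auto

definition computes :: "com \<Rightarrow> (nat \<Rightarrow> nat) \<Rightarrow> nat \<Rightarrow> nat \<Rightarrow> nat \<Rightarrow> bool" where
  "computes c s d b y \<longleftrightarrow> (\<exists>s'. exec c s s' \<and> s' d = y \<and> (\<forall>i<b. i \<noteq> d \<longrightarrow> s' i = s i))"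

text \<open>A derivation unwinds from \<open>n\<close> downwards, whereas the compiled loop counts
  upwards; the sequence \<open>h\<close> of intermediate values supplies the loop invariant.\<close>

lemma Prec_trace:
  assumes "rec_eval (Prec f g) (n # xs) z"
  shows "\<exists>h. rec_eval f xs (h 0) \<and> (\<forall>i<n. rec_eval g (i # h i # xs) (h (Suc i))) \<and> h n = z"
  using assms
proof (induction n arbitrary: z)
  case 0
  then show ?case by cases auto
next
  case (Suc n)
  from Suc.prems obtain y where y: "rec_eval (Prec f g) (n # xs) y" "rec_eval g (n # y # xs) z"
    by cases auto
  from Suc.IH[OF y(1)] obtain h where "rec_eval f xs (h 0)"
    "\<forall>i<n. rec_eval g (i # h i # xs) (h (Suc i))" "h n = y"
    by blast
  with y(2) show ?case
    by (intro exI[of _ "h(Suc n := z)"]) (auto simp: less_Suc_eq)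
qed

text \<open>The target \<open>d\<close> must differ from the arguments because \<open>COPY\<close>
  clears it before reading them. Nested calls stay apart because each gets its scratch space above
  all registers still in use.\<close>

lemma compile_correct:
  assumes "rec_eval r (map s as) y" "\<forall>a\<in>set as. a < b" "d < b" "d \<notin> set as"
  shows "computes (compile r as d b) s d b y"
  using assms
proof (induction r arbitrary: as s y d b)
  case Zero
  from Zero.prems(1) have "y = 0"
    by cases
  then show ?case
    using exec_CLEAR[of d s] by (auto simp: computes_def)
next
  case Succ
  from Succ.prems(1) obtain a where [simp]: "as = [a]" and y: "y = Suc (s a)"
    by cases auto
  have "exec (compile Succ as d b) s (s(d := s a, b := 0, d := Suc (s a)))"
    using exec_SEQ[OF exec_COPY exec_INC, of a d b d s] Succ.prems by simp
  then show ?case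
    using y by (auto simp: computes_def)
next
  case (Proj i)
  from Proj.prems(1) have i: "i < length as" and y: "y = s (as ! i)"
    by (cases; simp)+
  then have "as ! i < b" "as ! i \<noteq> d"
    using Proj.prems by auto
  then show ?case
    using exec_COPY[of "as ! i" d b s] y Proj.prems by (auto simp: computes_def)
next
  case (Comp f gs)
  from Comp.prems(1) obtain ys where ys: "list_all2 (\<lambda>g y. rec_eval g (map s as) y) gs ys"
    and z: "rec_eval f ys y"
    by cases auto
  define m where "m = length gs"
  have len: "length ys = m"
    using ys by (simp add: m_def list_all2_lengthD)
  define cs where "cs = map (\<lambda>(g, j). compile g as (b + j) (b + m)) (zip gs [0..<m])"
  \<comment> \<open>The values already computed lie below the scratch space, which begins at
    \<open>b + m\<close>, so later evaluations leave them alone.\<close>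
  have "\<exists>s'. exec (foldr SEQ (drop k cs) SKIP) t s' \<and> (\<forall>j<m. s' (b + j) = ys ! j) \<and> (\<forall>i<b. s' i = s i)"
    if "k \<le> m" "\<forall>j<k. t (b + j) = ys ! j" "\<forall>i<b. t i = s i" for k t
    using that
  proof (induction "m - k" arbitrary: k t)
    case 0
    then show ?case
      by (auto simp: cs_def m_def intro!: exec_SKIP exI[of _ t])
  next
    case (Suc l)
    then have k: "k < m"
      by simp
    then have dr: "drop k cs = compile (gs ! k) as (b + k) (b + m) # drop (Suc k) cs"
      by (subst Cons_nth_drop_Suc[symmetric]) (auto simp: cs_def m_def)
    have "map t as = map s as"
      using Suc.prems(3) Comp.prems(2) by auto
    moreover have "rec_eval (gs ! k) (map s as) (ys ! k)"
      using ys k by (simp add: list_all2_conv_all_nth m_def)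
    ultimately have rec: "rec_eval (gs ! k) (map t as) (ys ! k)"
      by metis
    have "gs ! k \<in> set gs" "b + k < b + m" "\<forall>a\<in>set as. a < b + m" "b + k \<notin> set as"
      using k Comp.prems(2) by (force simp: m_def)+
    from Comp.IH(2)[OF this(1) rec this(3,2,4)]
    have "computes (compile (gs ! k) as (b + k) (b + m)) t (b + k) (b + m) (ys ! k)" .
    then obtain t' where t': "exec (compile (gs ! k) as (b + k) (b + m)) t t'" "t' (b + k) = ys ! k"
      "\<forall>i<b + m. i \<noteq> b + k \<longrightarrow> t' i = t i"
      by (auto simp: computes_def)
    have "\<exists>s'. exec (foldr SEQ (drop (Suc k) cs) SKIP) t' s' \<and> (\<forall>j<m. s' (b + j) = ys ! j)
        \<and> (\<forall>i<b. s' i = s i)"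
      using Suc.hyps(2) Suc.prems(2,3) k t' by (intro Suc.hyps(1)) (auto simp: less_Suc_eq)
    with t'(1) show ?case
      unfolding dr foldr.simps comp_apply by (metis exec_SEQ)
  qed
  from this[of 0 s] obtain s1 where s1: "exec (foldr SEQ cs SKIP) s s1" "\<forall>j<m. s1 (b + j) = ys ! j"
      "\<forall>i<b. s1 i = s i"
    by auto
  have "map s1 [b..<b + m] = ys"
    using s1(2) len by (auto simp: list_eq_iff_nth_eq)
  with z have "rec_eval f (map s1 [b..<b + m]) y"
    by metis
  then have "computes (compile f [b..<b + m] d (b + m)) s1 d (b + m) y"
    by (rule Comp.IH(1)) (use Comp.prems in auto)
  then obtain s2 where s2: "exec (compile f [b..<b + m] d (b + m)) s1 s2" "s2 d = y"
    "\<forall>i<b + m. i \<noteq> d \<longrightarrow> s2 i = s1 i"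
    by (auto simp: computes_def)
  have "exec (compile (Comp f gs) as d b) s s2"
    using exec_SEQ[OF s1(1) s2(1)] by (simp add: Let_def cs_def m_def)
  with s1 s2 show ?case
    by (auto simp: computes_def)
next
  \<comment> \<open>Register \<open>b\<close> counts the rounds left, \<open>b + 1\<close> the
    rounds done, \<open>b + 2\<close> holds the value reached and \<open>b + 3\<close> receives the
    next one.\<close>
  case (Prec f g)
  then obtain a as' where [simp]: "as = a # as'"
    by (cases as) (auto elim: rec_eval.cases)
  from Prec_trace[of f g "s a" "map s as'" y] Prec.prems obtain h
    where h0: "rec_eval f (map s as') (h 0)"
      and hSuc: "\<And>i. i < s a \<Longrightarrow> rec_eval g (i # h i # map s as') (h (Suc i))" and hn: "h (s a) = y"
    by auto
  define s1 where "s1 = s(b := s a, b + 1 := 0)"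
  have e1: "exec (COPY a b (b + 1)) s s1"
    using exec_COPY[of a b "b + 1" s] Prec.prems by (simp add: s1_def)
  have e2: "exec (CLEAR (b + 1)) s1 s1"
    using exec_CLEAR[of "b + 1" s1] by (simp add: s1_def)
  have eq: "map t as' = map s as'" if "\<forall>i<b. t i = s i" for t
    using that Prec.prems by auto
  have fresh: "x < b" if "x \<in> set as'" for x
    using that Prec.prems(2) by simp
  have "computes (compile f as' (b + 2) (b + 3)) s1 (b + 2) (b + 3) (h 0)"
  proof (rule Prec.IH(1))
    have "map s1 as' = map s as'"
      using eq[of s1] by (simp add: s1_def)
    with h0 show "rec_eval f (map s1 as') (h 0)"
      by metis
  qed (auto dest!: fresh)
  then obtain s2 where e3: "exec (compile f as' (b + 2) (b + 3)) s1 s2" and s2: "s2 (b + 2) = h 0"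
    "\<forall>i<b + 3. i \<noteq> b + 2 \<longrightarrow> s2 i = s1 i"
    by (auto simp: computes_def)
  let ?body = "SEQ (compile g ((b + 1) # (b + 2) # as') (b + 3) (b + 4))
      (SEQ (COPY (b + 3) (b + 2) (b + 4)) (INC (b + 1)))"
  have loop: "\<exists>t'. exec (LOOP b ?body) t t' \<and> t' (b + 2) = h (s a) \<and> (\<forall>i<b. t' i = s i)"
    if "t (b + 1) + t b = s a" "t (b + 2) = h (t (b + 1))" "\<forall>i<b. t i = s i" for t
    using that
  proof (induction "t b" arbitrary: t)
    case 0
    then show ?case
      by (intro exI[of _ t]) (auto intro: exec_LOOP_0)
  next
    case (Suc n)
    let ?t = "t(b := t b - 1)"
    have "computes (compile g ((b + 1) # (b + 2) # as') (b + 3) (b + 4)) ?t (b + 3) (b + 4)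
        (h (Suc (t (b + 1))))"
    proof (rule Prec.IH(2))
      have "map ?t as' = map s as'"
        using eq[of ?t] Suc.prems(3) by simp
      then have "map ?t ((b + 1) # (b + 2) # as') = t (b + 1) # h (t (b + 1)) # map s as'"
        using Suc.prems(2) by simp
      moreover have "t (b + 1) < s a"
        using Suc.hyps(2) Suc.prems(1) by simp
      ultimately show "rec_eval g (map ?t ((b + 1) # (b + 2) # as')) (h (Suc (t (b + 1))))"
        using hSuc by metis
    qed (auto dest!: fresh)
    then obtain t1 where t1: "exec (compile g ((b + 1) # (b + 2) # as') (b + 3) (b + 4)) ?t t1"
      "t1 (b + 3) = h (Suc (t (b + 1)))" "\<forall>i<b + 4. i \<noteq> b + 3 \<longrightarrow> t1 i = ?t i"
      by (auto simp: computes_def)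
    define t2 where "t2 = t1(b + 2 := t1 (b + 3), b + 4 := 0)"
    define t3 where "t3 = t2(b + 1 := Suc (t2 (b + 1)))"
    have copy: "exec (COPY (b + 3) (b + 2) (b + 4)) t1 t2"
      unfolding t2_def by (rule exec_COPY) auto
    have body: "exec ?body ?t t3"
      unfolding t3_def by (rule exec_SEQ[OF t1(1) exec_SEQ[OF copy exec_INC]])
    have "n = t3 b" "t3 (b + 1) + t3 b = s a" "t3 (b + 2) = h (t3 (b + 1))" "\<forall>i<b. t3 i = s i"
      using t1 Suc.hyps(2) Suc.prems by (auto simp: t3_def t2_def)
    from Suc.hyps(1)[OF this] Suc.hyps(2) show ?case
      using exec_LOOP_Suc[OF _ body] by fastforce
  qed
  obtain s3 where e4: "exec (LOOP b ?body) s2 s3" and s3: "s3 (b + 2) = h (s a)" "\<forall>i<b. s3 i = s i"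
    using loop[of s2] s2 by (auto simp: s1_def)
  have e5: "exec (COPY (b + 2) d b) s3 (s3(d := s3 (b + 2), b := 0))"
    using Prec.prems by (intro exec_COPY) auto
  have "exec (compile (Prec f g) as d b) s (s3(d := s3 (b + 2), b := 0))"
    using exec_SEQ[OF e1 exec_SEQ[OF e2 exec_SEQ[OF e3 exec_SEQ[OF e4 e5]]]] by simp
  then show ?case
    using s3 hn Prec.prems by (auto simp: computes_def intro!: exI[of _ "s3(d := s3 (b + 2), b := 0)"])
next
  \<comment> \<open>\<open>LOOP\<close> performs an unbounded search because its body overwrites the
    loop register \<open>b + 1\<close> with the next value of \<open>f\<close>; it stops at the
    first value 0.\<close>
  case (Mu f)
  from Mu.prems(1) have y: "rec_eval f (y # map s as) 0"
    "\<forall>k<y. \<exists>z. rec_eval f (k # map s as) (Suc z)"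
    by (cases; simp)+
  define s1 where "s1 = s(b := 0)"
  let ?c = "compile f (b # as) (b + 1) (b + 2)"
  have eq: "map t as = map s as" if "\<forall>i<b. t i = s i" for t
    using that Mu.prems by auto
  have fresh: "x < b" if "x \<in> set as" for x
    using that Mu.prems(2) by simp
  have step: "computes ?c t (b + 1) (b + 2) z"
    if "rec_eval f (t b # map s as) z" "\<forall>i<b. t i = s i" for t z
  proof (rule Mu.IH)
    have "map t (b # as) = t b # map s as"
      using eq[OF that(2)] by simp
    with that(1) show "rec_eval f (map t (b # as)) z"
      by metis
  qed (auto dest!: fresh)
  \<comment> \<open>The loop body ends with the evaluation that precedes the loop, so this
    combination recurs and allows induction on \<open>y - t b\<close>.\<close>
  have loop: "\<exists>t'. exec (SEQ ?c (LOOP (b + 1) (SEQ (INC b) ?c))) t t' \<and> t' b = y \<and> (\<forall>i<b. t' i = s i)"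
    if "t b \<le> y" "\<forall>i<b. t i = s i" for t
    using that
  proof (induction "y - t b" arbitrary: t)
    case 0
    then have "t b = y"
      by simp
    with step[of t 0] y 0 obtain t' where "exec ?c t t'" "t' (b + 1) = 0" "t' b = y" "\<forall>i<b. t' i = s i"
      by (auto simp: computes_def)
    then show ?case
      by (metis exec_SEQ exec_LOOP_0)
  next
    case (Suc n)
    then have "t b < y"
      by simp
    with y(2) obtain z where "rec_eval f (t b # map s as) (Suc z)"
      by blast
    with step[of t "Suc z"] Suc.prems obtain t1 where t1: "exec ?c t t1" "t1 (b + 1) = Suc z" "t1 b = t b"
      "\<forall>i<b. t1 i = s i"
      by (auto simp: computes_def)
    define t2 where "t2 = t1(b + 1 := t1 (b + 1) - 1, b := Suc (t b))"
    have inc: "exec (INC b) (t1(b + 1 := t1 (b + 1) - 1)) t2"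
      using exec_INC[of b "t1(b + 1 := t1 (b + 1) - 1)"] t1 by (simp add: t2_def)
    have "n = y - t2 b" "t2 b \<le> y" "\<forall>i<b. t2 i = s i"
      using t1 Suc.hyps(2) \<open>t b < y\<close> by (auto simp: t2_def)
    from Suc.hyps(1)[OF this] obtain t3 t' where t3: "exec ?c t2 t3"
      "exec (LOOP (b + 1) (SEQ (INC b) ?c)) t3 t'" "t' b = y" "\<forall>i<b. t' i = s i"
      by (auto elim!: exec_SEQ_E)
    have "exec (LOOP (b + 1) (SEQ (INC b) ?c)) t1 t'"
      using exec_LOOP_Suc[OF _ exec_SEQ[OF inc t3(1)] t3(2)] t1(2) by simp
    from exec_SEQ[OF t1(1) this] t3(3,4) show ?case
      by blast
  qed
  obtain s2 s3 where e: "exec ?c s1 s2" "exec (LOOP (b + 1) (SEQ (INC b) ?c)) s2 s3"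
    and s3: "s3 b = y" "\<forall>i<b. s3 i = s i"
    using loop[of s1] by (auto simp: s1_def elim!: exec_SEQ_E)
  have "exec (COPY b d (b + 1)) s3 (s3(d := s3 b, b + 1 := 0))"
    using Mu.prems by (intro exec_COPY) auto
  then have "exec (compile (Mu f) as d b) s (s3(d := s3 b, b + 1 := 0))"
    using exec_SEQ[OF exec_CLEAR[of b s, folded s1_def] exec_SEQ[OF e(1) exec_SEQ[OF e(2)]]] by simp
  then show ?case
    using s3 Mu.prems by (auto simp: computes_def intro!: exI[of _ "s3(d := s3 b, b + 1 := 0)"])
qed

section \<open>A rewriting system interpreting loop programs\<close>

definition srs_step :: "('a list \<times> 'a list) set \<Rightarrow> 'a list \<Rightarrow> 'a list \<Rightarrow> bool" where
  "srs_step R x y \<longleftrightarrow> (\<exists>u v. \<exists>(l, r)\<in>R. x = u @ l @ v \<and> y = u @ r @ v)"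

abbreviation srs :: "('a list \<times> 'a list) set \<Rightarrow> 'a list \<Rightarrow> 'a list \<Rightarrow> bool" where
  "srs R \<equiv> (srs_step R)\<^sup>*\<^sup>*"

lemma srs_step_context:
  assumes "srs_step R x y"
  shows "srs_step R (u @ x @ v) (u @ y @ v)"
proof -
  obtain u' v' l r where "(l, r) \<in> R" "x = u' @ l @ v'" "y = u' @ r @ v'"
    using assms by (auto simp: srs_step_def)
  then show ?thesis
    unfolding srs_step_def by (intro exI[of _ "u @ u'"] exI[of _ "v' @ v"] bexI[of _ "(l, r)"]) auto
qed

lemma srs_context: "srs R x y \<Longrightarrow> srs R (u @ x @ v) (u @ y @ v)"
  by (induction rule: rtranclp_induct) (auto intro: rtranclp.rtrancl_into_rtrancl srs_step_context)

lemma srs_rule: "(l, r) \<in> R \<Longrightarrow> srs R (u @ l @ v) (u @ r @ v)"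
  unfolding srs_step_def by (intro r_into_rtranclp) blast

lemma srs_right:
  "(\<And>a. a \<in> set w \<Longrightarrow> ([m, a], [a, m]) \<in> R) \<Longrightarrow> srs R (u @ m # w @ v) (u @ w @ m # v)"
proof (induction w arbitrary: u)
  case (Cons a w)
  have "srs R (u @ [m, a] @ w @ v) (u @ [a, m] @ w @ v)"
    using Cons.prems by (intro srs_rule) auto
  moreover have "srs R ((u @ [a]) @ m # w @ v) ((u @ [a]) @ w @ m # v)"
    using Cons.prems by (intro Cons.IH) auto
  ultimately show ?case by simp
qed simp

lemma srs_left:
  "(\<And>a. a \<in> set w \<Longrightarrow> ([a, m], [m, a]) \<in> R) \<Longrightarrow> srs R (u @ w @ m # v) (u @ m # w @ v)"
proof (induction w arbitrary: v rule: rev_induct)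
  case (snoc a w)
  have "srs R ((u @ w) @ [a, m] @ v) ((u @ w) @ [m, a] @ v)"
    using snoc.prems by (intro srs_rule) auto
  moreover have "srs R (u @ w @ m # (a # v)) (u @ m # w @ (a # v))"
    using snoc.prems by (intro snoc.IH) auto
  ultimately show ?case by simp
qed simp

text \<open>
  The rules below interpret words \<open>LEnd, program, Bound, tape, REnd\<close>. The cursor \<open>Run\<close> moves through
  the program. At an instruction that concerns the tape it leaves the mark \<open>Cur\<close> and sends a message
  to the letter \<open>Head\<close>, which replaces the letter \<open>Cell\<close> at the start of one of the unary registers;
  the answer travels back to the mark, and \<open>Home\<close> also returns the head to the first register.
  \<open>TEST\<close> decrements a nonzero register, and at zero it makes the cursor \<open>Skip\<close> to the matching
  \<open>CLOSE\<close>. Brackets are matched without counting: an \<open>OPEN\<close> is marked as \<open>Opened True\<close> when it is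
  executed and as \<open>Opened False\<close> when it is skipped, and is unmarked when its loop is left, so that
  at every \<open>CLOSE\<close> the nearest mark to the left is the matching one. \<open>FAILS\<close> has no rule.
\<close>

datatype instr = NOP | RIGHT | INCR | TEST | OPEN | CLOSE | FAILS

datatype sym = Ins instr | Cur instr | Opened bool | LEnd | Bound | REnd | Cell | Head | One
  | Run | Skip | Msg instr | Look instr | Home bool | Top bool | Reply bool | Back | Unmark
  | Resume bool | EatR | EatL | Halt

inductive_set rules :: "(sym list \<times> sym list) set" where
  run_NOP: "([Run, Ins NOP], [Ins NOP, Run]) \<in> rules"
| run_send: "i \<in> {RIGHT, INCR, TEST} \<Longrightarrow> ([Run, Ins i], [Cur i, Msg i]) \<in> rules"
| run_OPEN: "([Run, Ins OPEN], [Opened True, Run]) \<in> rules"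
| run_CLOSE: "([Run, Ins CLOSE], [Back, Ins CLOSE]) \<in> rules"
| msg_move: "a \<in> {Bound, Cell, One} \<union> range Ins \<Longrightarrow> ([Msg i, a], [a, Msg i]) \<in> rules"
| msg_INCR: "([Msg INCR, Head], [Home True, Cell, One]) \<in> rules"
| msg_look: "i \<in> {RIGHT, TEST} \<Longrightarrow> ([Msg i, Head], [Cell, Look i]) \<in> rules"
| look_RIGHT_One: "([Look RIGHT, One], [One, Look RIGHT]) \<in> rules"
| look_RIGHT_Cell: "([Look RIGHT, Cell], [Reply True, Head]) \<in> rules"
| look_TEST_One: "([Look TEST, One], [Home True]) \<in> rules"
| look_TEST_zero: "a \<in> {Cell, REnd} \<Longrightarrow> ([Look TEST, a], [Home False, a]) \<in> rules"
| home_move: "a \<in> {Cell, One} \<Longrightarrow> ([a, Home b], [Home b, a]) \<in> rules"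
| home_top: "([Bound, Home b], [Bound, Top b]) \<in> rules"
| top_cell: "([Top b, Cell], [Reply b, Head]) \<in> rules"
| reply_move: "a \<in> {Bound, Cell, One} \<union> range Ins \<Longrightarrow> ([a, Reply b], [Reply b, a]) \<in> rules"
| reply_cur: "([Cur i, Reply b], [Ins i, if b then Run else Skip]) \<in> rules"
| back_move: "([Ins i, Back], [Back, Ins i]) \<in> rules"
| back_open: "([Opened True, Back], [Run, Ins OPEN]) \<in> rules"
| skip_move: "i \<notin> {OPEN, CLOSE} \<Longrightarrow> ([Skip, Ins i], [Ins i, Skip]) \<in> rules"
| skip_OPEN: "([Skip, Ins OPEN], [Opened False, Skip]) \<in> rules"
| skip_CLOSE: "([Skip, Ins CLOSE], [Unmark, Cur CLOSE]) \<in> rules"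
| unmark_move: "([Ins i, Unmark], [Unmark, Ins i]) \<in> rules"
| unmark_opened: "([Opened b, Unmark], [Ins OPEN, Resume b]) \<in> rules"
| resume_move: "([Resume b, Ins i], [Ins i, Resume b]) \<in> rules"
| resume_cur: "([Resume b, Cur CLOSE], [Ins CLOSE, if b then Run else Skip]) \<in> rules"
| run_end: "([Run, Bound], [EatR]) \<in> rules"
| eatR: "a \<in> {Cell, Head, One} \<Longrightarrow> ([EatR, a], [EatR]) \<in> rules"
| eatR_end: "([EatR, REnd], [EatL]) \<in> rules"
| eatL: "([Ins i, EatL], [EatL]) \<in> rules"
| eatL_end: "([LEnd, EatL], [Halt]) \<in> rules"

section \<open>Determinism of the rewriting rules\<close>

text \<open>The rules of an active letter consult only one of its two neighbours, always on the same
  side; so a unique active letter fixes the place of rewriting.\<close>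

fun right_looking :: "sym \<Rightarrow> bool" where
  "right_looking Run = True"
| "right_looking Skip = True"
| "right_looking (Msg i) = True"
| "right_looking (Look i) = True"
| "right_looking (Top b) = True"
| "right_looking (Resume b) = True"
| "right_looking EatR = True"
| "right_looking _ = False"

fun left_looking :: "sym \<Rightarrow> bool" where
  "left_looking (Home b) = True"
| "left_looking (Reply b) = True"
| "left_looking Back = True"
| "left_looking Unmark = True"
| "left_looking EatL = True"
| "left_looking _ = False"

text \<open>\<open>Halt\<close> has no rule; it is counted as active so that every right-hand side
  contains exactly one active letter.\<close>

definition active :: "sym \<Rightarrow> bool" where
  "active a \<longleftrightarrow> right_looking a \<or> left_looking a \<or> a = Halt"

lemma rules_lhs:
  "(l, r) \<in> rules \<Longrightarrow> (\<exists>q a. l = [q, a] \<and> right_looking q \<and> \<not> active a)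
     \<or> (\<exists>q a. l = [a, q] \<and> left_looking q \<and> \<not> active a)"
  by (induction l r rule: rules.induct) (auto simp: active_def)

lemma rules_rhs: "(l, r) \<in> rules \<Longrightarrow> length (filter active r) = 1"
  by (induction l r rule: rules.induct) (auto simp: active_def)

text \<open>Bounded length over a finite alphabet makes the rule set finite; non-empty sides give
  every tile word a first letter.\<close>

lemma rules_length: "(l, r) \<in> rules \<Longrightarrow> l \<noteq> [] \<and> r \<noteq> [] \<and> length l \<le> 3 \<and> length r \<le> 3"
  by (induction l r rule: rules.induct) auto

lemma rules_functional: "(l, r) \<in> rules \<Longrightarrow> (l, r') \<in> rules \<Longrightarrow> r = r'"
  by (erule rules.cases; erule rules.cases; simp) auto

lemma left_right_looking: "\<not> (left_looking q \<and> right_looking q)"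
  by (cases q) auto

definition one_active :: "sym list \<Rightarrow> bool" where
  "one_active w \<longleftrightarrow> length (filter active w) = 1"

lemma one_active_split:
  assumes "one_active w" "w = x @ q # y" "active q"
  shows "x = takeWhile (Not \<circ> active) w \<and> q # y = dropWhile (Not \<circ> active) w"
proof -
  have "filter active x = []"
    using assms unfolding one_active_def by simp
  then have "\<forall>a\<in>set x. \<not> active a"
    by (simp add: filter_empty_conv)
  then show ?thesis
    using assms(2,3) by (simp add: takeWhile_append dropWhile_append)
qed

lemma rules_step_cases:
  assumes "srs_step rules w x"
  obtains p q a s r where "w = p @ q # a # s" "right_looking q" "([q, a], r) \<in> rules" "x = p @ r @ s"
  | p q a s r where "w = (p @ [a]) @ q # s" "left_looking q" "([a, q], r) \<in> rules" "x = p @ r @ s"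
proof -
  from assms obtain u v l r where R: "(l, r) \<in> rules" "w = u @ l @ v" "x = u @ r @ v"
    by (auto simp: srs_step_def)
  from rules_lhs[OF R(1)] show thesis
  proof (elim disjE exE conjE)
    fix q a assume "l = [q, a]" "right_looking q"
    with R show thesis
      by (intro that(1)[of u q a v r]) auto
  next
    fix q a assume "l = [a, q]" "left_looking q"
    with R show thesis
      by (intro that(2)[of u a q v r]) auto
  qed
qed

lemma one_active_unique:
  assumes "one_active w" "w = x @ q # y" "w = x' @ q' # y'" "active q" "active q'"
  shows "x = x' \<and> q = q' \<and> y = y'"
proof -
  have "x = x'" "q # y = q' # y'"
    using one_active_split[OF assms(1,2,4)] one_active_split[OF assms(1,3,5)] by simp_all
  then show ?thesis by simp
qed

lemma active_looking: "right_looking q \<Longrightarrow> active q" "left_looking q \<Longrightarrow> active q"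
  by (simp_all add: active_def)

lemma rules_step_right:
  assumes "one_active (p @ q # a # s)" "right_looking q" "srs_step rules (p @ q # a # s) x"
  shows "\<exists>r. ([q, a], r) \<in> rules \<and> x = p @ r @ s"
  using assms(3)
proof (cases rule: rules_step_cases)
  case (1 p' q' a' s' r)
  with one_active_unique[OF assms(1) refl 1(1)] assms(2) show ?thesis
    by (auto simp: active_looking)
next
  case (2 p' q' a' s' r)
  with one_active_unique[OF assms(1) refl 2(1)] assms(2) left_right_looking[of q] show ?thesis
    by (auto simp: active_looking)
qed

lemma rules_step_left:
  assumes "one_active ((p @ [a]) @ q # s)" "left_looking q" "srs_step rules ((p @ [a]) @ q # s) x"
  shows "\<exists>r. ([a, q], r) \<in> rules \<and> x = p @ r @ s"
  using assms(3)
proof (cases rule: rules_step_cases)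
  case (1 p' q' a' s' r)
  with one_active_unique[OF assms(1) refl 1(1)] assms(2) left_right_looking[of q] show ?thesis
    by (auto simp: active_looking)
next
  case (2 p' q' a' s' r)
  with one_active_unique[OF assms(1) refl 2(1)] assms(2) show ?thesis
    by (auto simp: active_looking)
qed

lemma rules_step_deterministic:
  assumes "one_active w" "srs_step rules w x" "srs_step rules w y"
  shows "x = y"
  using assms(2)
proof (cases rule: rules_step_cases)
  case (1 p q a s r)
  with rules_step_right[of p q a s y] assms(1,3) show ?thesis
    by (auto dest: rules_functional)
next
  case (2 p q a s r)
  with rules_step_left[of p a q s y] assms(1,3) show ?thesis
    by (auto dest: rules_functional)
qed

lemma one_active_step:
  assumes "one_active w" "srs_step rules w x"
  shows "one_active x"
proof -
  from assms(2) obtain u v l r where R: "(l, r) \<in> rules" and w: "w = u @ l @ v" "x = u @ r @ v"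
    by (auto simp: srs_step_def)
  have "length (filter active l) = 1"
    using rules_lhs[OF R] by (auto simp: active_def)
  with rules_rhs[OF R] assms(1) w show ?thesis
    by (simp add: one_active_def)
qed

text \<open>Unreachability is proved by exhibiting another stuck word: a deterministic run ends in
  only one irreducible word.\<close>

lemma rules_unique_normal_form:
  assumes "srs rules w x" "srs rules w y" "one_active w"
    "\<And>z. \<not> srs_step rules x z" "\<And>z. \<not> srs_step rules y z"
  shows "x = y"
  using assms
proof (induction rule: converse_rtranclp_induct)
  case base
  from base(1,3) show ?case
    by (auto elim: converse_rtranclpE)
next
  case (step w w')
  from step.prems(1) step.prems(4) step.hyps(1) obtain w'' where "srs_step rules w w''" "srs rules w'' y"
    by (cases rule: converse_rtranclpE) auto
  moreover have "w'' = w'"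
    using calculation step rules_step_deterministic by blast
  ultimately show ?case
    using step one_active_step by blast
qed

lemma Halt_irreducible: "\<not> srs_step rules [Halt] z"
proof
  assume "srs_step rules [Halt] z"
  then show False
    by (cases rule: rules_step_cases) (auto simp: Cons_eq_append_conv)
qed

lemma FAILS_irreducible:
  assumes "one_active (p @ Run # Ins FAILS # s)"
  shows "\<not> srs_step rules (p @ Run # Ins FAILS # s) z"
proof
  assume "srs_step rules (p @ Run # Ins FAILS # s) z"
  from rules_step_right[OF assms _ this] obtain r where "([Run, Ins FAILS], r) \<in> rules"
    by auto
  then show False
    by cases auto
qed

section \<open>Simulation of loop programs on the tape\<close>

definition cells :: "(nat \<Rightarrow> nat) \<Rightarrow> nat \<Rightarrow> nat \<Rightarrow> sym list" where
  "cells s j k = concat (map (\<lambda>i. Cell # replicate (s i) One) [j..<k])"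

definition tape :: "nat \<Rightarrow> (nat \<Rightarrow> nat) \<Rightarrow> nat \<Rightarrow> sym list" where
  "tape h s n = cells s 0 h @ Head # replicate (s h) One @ cells s (Suc h) n @ [REnd]"

lemma set_cells: "set (cells s j k) \<subseteq> {Cell, One}"
  by (auto simp: cells_def)

lemma cells_cong: "(\<And>i. j \<le> i \<Longrightarrow> i < k \<Longrightarrow> s i = s' i) \<Longrightarrow> cells s j k = cells s' j k"
  unfolding cells_def by (intro arg_cong[of _ _ concat] map_cong) auto

lemma cells_Suc: "j \<le> k \<Longrightarrow> cells s j (Suc k) = cells s j k @ Cell # replicate (s k) One"
  by (simp add: cells_def)

lemma cells_rec: "j < k \<Longrightarrow> cells s j k = Cell # replicate (s j) One @ cells s (Suc j) k"
  by (simp add: cells_def upt_conv_Cons)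

lemma cells_empty: "k \<le> j \<Longrightarrow> cells s j k = []"
  by (simp add: cells_def)

lemma cells_split: "h < n \<Longrightarrow> cells s 0 n = cells s 0 h @ Cell # replicate (s h) One @ cells s (Suc h) n"
  using cells_rec[of h n s] upt_add_eq_append[of 0 h "n - h"]
  by (simp add: cells_def)

lemmas [trans] = rtranclp_trans

lemma tape_message:
  assumes "i \<in> {RIGHT, INCR, TEST}"
  shows "srs rules (u @ Run # Ins i # map Ins v @ Bound # tape h s n)
    (u @ Cur i # map Ins v @ Bound # cells s 0 h @ Msg i # Head # replicate (s h) One
       @ cells s (Suc h) n @ [REnd])"
proof -
  let ?t = "Head # replicate (s h) One @ cells s (Suc h) n @ [REnd]"
  have "srs rules (u @ Run # Ins i # map Ins v @ Bound # tape h s n)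
      (u @ Cur i # Msg i # map Ins v @ Bound # tape h s n)"
    using srs_rule[OF run_send[OF assms], of u "map Ins v @ Bound # tape h s n"] by simp
  also have "srs rules \<dots> (u @ Cur i # map Ins v @ Bound # cells s 0 h @ Msg i # ?t)"
    using srs_right[of "map Ins v @ Bound # cells s 0 h" "Msg i" rules "u @ [Cur i]" ?t]
      msg_move[of _ i] set_cells[of s 0 h] by (fastforce simp: tape_def)
  finally show ?thesis .
qed

lemma reply_to_cursor:
  assumes "set xs \<subseteq> {Cell, One}"
  shows "srs rules (u @ Cur i # map Ins v @ Bound # xs @ Reply b # y)
    (u @ Ins i # (if b then Run else Skip) # map Ins v @ Bound # xs @ y)"
proof -
  have "srs rules (u @ Cur i # map Ins v @ Bound # xs @ Reply b # y)
      (u @ Cur i # Reply b # map Ins v @ Bound # xs @ y)"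
    using srs_left[of "map Ins v @ Bound # xs" "Reply b" rules "u @ [Cur i]" y]
      reply_move[of _ b] assms by fastforce
  also have "srs rules \<dots> (u @ Ins i # (if b then Run else Skip) # map Ins v @ Bound # xs @ y)"
    using srs_rule[OF reply_cur, of u i b "map Ins v @ Bound # xs @ y"] by simp
  finally show ?thesis .
qed

text \<open>When \<open>Home\<close> is released, the head has already been turned into an ordinary
  \<open>Cell\<close>, so the tape is the plain list of registers; its first \<open>Cell\<close>
  becomes the new head.\<close>

lemma home_to_cursor:
  assumes "set xs \<subseteq> {Cell, One}" "xs @ y = cells s 0 n @ [REnd]" "0 < n"
  shows "srs rules (u @ Cur i # map Ins v @ Bound # xs @ Home b # y)
    (u @ Ins i # (if b then Run else Skip) # map Ins v @ Bound # tape 0 s n)"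
proof -
  let ?t = "replicate (s 0) One @ cells s (Suc 0) n @ [REnd]"
  let ?u = "u @ Cur i # map Ins v"
  have xy: "xs @ y = Cell # ?t"
    using assms(2) cells_rec[OF assms(3)] by simp
  have "srs rules (u @ Cur i # map Ins v @ Bound # xs @ Home b # y)
      (u @ Cur i # map Ins v @ Bound # Home b # xs @ y)"
    using srs_left[of xs "Home b" rules "?u @ [Bound]" y] home_move[of _ b] assms(1) by fastforce
  also have "srs rules \<dots> (u @ Cur i # map Ins v @ Bound # Top b # xs @ y)"
    using srs_rule[OF home_top, of ?u b "xs @ y"] by simp
  also have "srs rules \<dots> (u @ Cur i # map Ins v @ Bound # Reply b # Head # ?t)"
    unfolding xy using srs_rule[OF top_cell, of "?u @ [Bound]" b ?t] by simp
  also have "srs rules \<dots> (u @ Ins i # (if b then Run else Skip) # map Ins v @ Bound # Head # ?t)"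
    using reply_to_cursor[of "[]" u i v b "Head # ?t"] by simp
  finally show ?thesis
    by (simp add: tape_def cells_empty)
qed

lemma run_RIGHT:
  assumes "Suc h < n"
  shows "srs rules (u @ Run # Ins RIGHT # map Ins v @ Bound # tape h s n)
    (u @ Ins RIGHT # Run # map Ins v @ Bound # tape (Suc h) s n)"
proof -
  let ?t = "replicate (s (Suc h)) One @ cells s (Suc (Suc h)) n @ [REnd]"
  let ?u = "u @ Cur RIGHT # map Ins v @ Bound # cells s 0 h"
  have block: "set (cells s 0 h @ Cell # replicate (s h) One) \<subseteq> {Cell, One}"
    using set_cells[of s 0 h] by auto
  have rest: "cells s (Suc h) n @ [REnd] = Cell # ?t"
    using cells_rec[OF assms] by simp
  have "srs rules (u @ Run # Ins RIGHT # map Ins v @ Bound # tape h s n)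
      (?u @ Msg RIGHT # Head # replicate (s h) One @ Cell # ?t)"
    using tape_message[of RIGHT u v h s n] rest by simp
  also have "srs rules \<dots> (?u @ Cell # Look RIGHT # replicate (s h) One @ Cell # ?t)"
    using srs_rule[OF msg_look, of RIGHT ?u "replicate (s h) One @ Cell # ?t"] by simp
  also have "srs rules \<dots> (?u @ Cell # replicate (s h) One @ Look RIGHT # Cell # ?t)"
    using srs_right[of "replicate (s h) One" "Look RIGHT" rules "?u @ [Cell]" "Cell # ?t"]
      look_RIGHT_One by simp
  also have "srs rules \<dots> (?u @ Cell # replicate (s h) One @ Reply True # Head # ?t)"
    using srs_rule[OF look_RIGHT_Cell, of "?u @ Cell # replicate (s h) One" ?t] by simp
  also have "srs rules \<dots> (u @ Ins RIGHT # Run # map Ins v @ Bound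
      # (cells s 0 h @ Cell # replicate (s h) One) @ Head # ?t)"
    using reply_to_cursor[OF block, of u RIGHT v True "Head # ?t"] by simp
  finally show ?thesis
    by (simp add: tape_def cells_Suc)
qed

lemma run_RIGHTs:
  "h + k < n \<Longrightarrow> srs rules (u @ Run # map Ins (replicate k RIGHT @ v) @ Bound # tape h s n)
    (u @ map Ins (replicate k RIGHT) @ Run # map Ins v @ Bound # tape (h + k) s n)"
proof (induction k arbitrary: u h)
  case (Suc k)
  have "srs rules (u @ Run # map Ins (replicate (Suc k) RIGHT @ v) @ Bound # tape h s n)
      (u @ Ins RIGHT # Run # map Ins (replicate k RIGHT @ v) @ Bound # tape (Suc h) s n)"
    using run_RIGHT[of h n u "replicate k RIGHT @ v" s] Suc.prems by simp
  also have "srs rules \<dots> (u @ map Ins (replicate (Suc k) RIGHT) @ Run # map Ins v @ Bound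
      # tape (h + Suc k) s n)"
    using Suc.IH[of "Suc h" "u @ [Ins RIGHT]"] Suc.prems by simp
  finally show ?case .
qed simp

lemma run_INCR:
  assumes "h < n"
  shows "srs rules (u @ Run # Ins INCR # map Ins v @ Bound # tape h s n)
    (u @ Ins INCR # Run # map Ins v @ Bound # tape 0 (s(h := Suc (s h))) n)"
proof -
  let ?s = "s(h := Suc (s h))"
  let ?t = "replicate (s h) One @ cells s (Suc h) n @ [REnd]"
  let ?u = "u @ Cur INCR # map Ins v @ Bound # cells s 0 h"
  have "srs rules (u @ Run # Ins INCR # map Ins v @ Bound # tape h s n) (?u @ Msg INCR # Head # ?t)"
    using tape_message[of INCR u v h s n] by simp
  also have "srs rules \<dots> (?u @ Home True # Cell # One # ?t)"
    using srs_rule[OF msg_INCR, of ?u ?t] by simp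
  also have "srs rules \<dots> (u @ Ins INCR # Run # map Ins v @ Bound # tape 0 ?s n)"
    using home_to_cursor[of "cells s 0 h" "Cell # One # ?t" ?s n u INCR v True] set_cells[of s 0 h]
      cells_split[OF assms, of ?s] cells_cong[of 0 h s ?s] cells_cong[of "Suc h" n s ?s] assms
    by simp
  finally show ?thesis .
qed

lemma run_TEST_nonzero:
  assumes "h < n" "0 < s h"
  shows "srs rules (u @ Run # Ins TEST # map Ins v @ Bound # tape h s n)
    (u @ Ins TEST # Run # map Ins v @ Bound # tape 0 (s(h := s h - 1)) n)"
proof -
  let ?s = "s(h := s h - 1)"
  let ?t = "replicate (s h - 1) One @ cells s (Suc h) n @ [REnd]"
  let ?u = "u @ Cur TEST # map Ins v @ Bound # cells s 0 h"
  have "srs rules (u @ Run # Ins TEST # map Ins v @ Bound # tape h s n) (?u @ Msg TEST # Head # One # ?t)"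
    using tape_message[of TEST u v h s n] assms(2) by (cases "s h") auto
  also have "srs rules \<dots> (?u @ Cell # Look TEST # One # ?t)"
    using srs_rule[OF msg_look, of TEST ?u "One # ?t"] by simp
  also have "srs rules \<dots> (?u @ Cell # Home True # ?t)"
    using srs_rule[OF look_TEST_One, of "?u @ [Cell]" ?t] by simp
  also have "srs rules \<dots> (u @ Ins TEST # Run # map Ins v @ Bound # tape 0 ?s n)"
    using home_to_cursor[of "cells s 0 h @ [Cell]" ?t ?s n u TEST v True] set_cells[of s 0 h]
      cells_split[OF assms(1), of ?s] cells_cong[of 0 h s ?s] cells_cong[of "Suc h" n s ?s] assms
    by simp
  finally show ?thesis .
qed

lemma run_TEST_zero:
  assumes "h < n" "s h = 0"
  shows "srs rules (u @ Run # Ins TEST # map Ins v @ Bound # tape h s n)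
    (u @ Ins TEST # Skip # map Ins v @ Bound # tape 0 s n)"
proof -
  let ?u = "u @ Cur TEST # map Ins v @ Bound # cells s 0 h"
  \<comment> \<open>An empty register is recognized by the letter after its start: the next
    \<open>Cell\<close>, or \<open>REnd\<close> for the last register.\<close>
  obtain a t where t: "cells s (Suc h) n @ [REnd] = a # t" "a \<in> {Cell, REnd}"
    using cells_rec[of "Suc h" n s] cells_empty[of n "Suc h" s] by (cases "Suc h < n") auto
  have "srs rules (u @ Run # Ins TEST # map Ins v @ Bound # tape h s n) (?u @ Msg TEST # Head # a # t)"
    using tape_message[of TEST u v h s n] assms(2) t by simp
  also have "srs rules \<dots> (?u @ Cell # Look TEST # a # t)"
    using srs_rule[OF msg_look, of TEST ?u "a # t"] by simp
  also have "srs rules \<dots> (?u @ Cell # Home False # a # t)"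
    using srs_rule[OF look_TEST_zero[OF t(2)], of "?u @ [Cell]" t] by simp
  also have "srs rules \<dots> (u @ Ins TEST # Skip # map Ins v @ Bound # tape 0 s n)"
    using home_to_cursor[of "cells s 0 h @ [Cell]" "a # t" s n u TEST v False] set_cells[of s 0 h]
      cells_split[OF assms(1), of s] assms t
    by simp
  finally show ?thesis .
qed

text \<open>\<open>INCR\<close> and \<open>TEST\<close> send the head back to register 0, so
  \<open>i\<close> moves from there reach register \<open>i\<close>; in a loop they stand after
  \<open>OPEN\<close>, so every round repeats them.\<close>

fun flatten :: "com \<Rightarrow> instr list" where
  "flatten SKIP = []"
| "flatten (INC i) = replicate i RIGHT @ [INCR]"
| "flatten (SEQ c d) = flatten c @ flatten d"
| "flatten (LOOP i c) = OPEN # replicate i RIGHT @ TEST # flatten c @ [CLOSE]"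
| "flatten FAIL = [FAILS]"

fun regs_below :: "nat \<Rightarrow> com \<Rightarrow> bool" where
  "regs_below n SKIP = True"
| "regs_below n (INC i) = (i < n)"
| "regs_below n (SEQ c d) = (regs_below n c \<and> regs_below n d)"
| "regs_below n (LOOP i c) = (i < n \<and> regs_below n c)"
| "regs_below n FAIL = True"

text \<open>As \<open>p\<close> carries no marks, \<open>Unmark\<close> stops at this
  \<open>Opened b\<close>; its Boolean tells whether the loop was executed or only skipped, and thus
  how the cursor goes on.\<close>

lemma skip_CLOSE_opened:
  "srs rules (u @ Opened b # map Ins p @ Skip # Ins CLOSE # v)
    (u @ Ins OPEN # map Ins p @ Ins CLOSE # (if b then Run else Skip) # v)"
proof -
  have "srs rules (u @ Opened b # map Ins p @ Skip # Ins CLOSE # v)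
      (u @ Opened b # map Ins p @ Unmark # Cur CLOSE # v)"
    using srs_rule[OF skip_CLOSE, of "u @ Opened b # map Ins p" v] by simp
  also have "srs rules \<dots> (u @ Opened b # Unmark # map Ins p @ Cur CLOSE # v)"
    using srs_left[of "map Ins p" Unmark rules "u @ [Opened b]" "Cur CLOSE # v"] unmark_move by fastforce
  also have "srs rules \<dots> (u @ Ins OPEN # Resume b # map Ins p @ Cur CLOSE # v)"
    using srs_rule[OF unmark_opened, of u b "map Ins p @ Cur CLOSE # v"] by simp
  also have "srs rules \<dots> (u @ Ins OPEN # map Ins p @ Resume b # Cur CLOSE # v)"
    using srs_right[of "map Ins p" "Resume b" rules "u @ [Ins OPEN]" "Cur CLOSE # v"] resume_move
    by fastforce
  also have "srs rules \<dots> (u @ Ins OPEN # map Ins p @ Ins CLOSE # (if b then Run else Skip) # v)"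
    using srs_rule[OF resume_cur, of "u @ Ins OPEN # map Ins p" b v] by simp
  finally show ?thesis .
qed

lemma skip_simple:
  "set p \<inter> {OPEN, CLOSE} = {} \<Longrightarrow> srs rules (u @ Skip # map Ins p @ v) (u @ map Ins p @ Skip # v)"
  by (intro srs_right) (auto intro!: skip_move)

text \<open>An inner \<open>CLOSE\<close> turns its \<open>Opened False\<close> back into
  \<open>OPEN\<close>, so no mark is left between the mark of an outer loop and its
  \<open>CLOSE\<close>.\<close>

lemma skip_flatten: "srs rules (u @ Skip # map Ins (flatten c) @ v) (u @ map Ins (flatten c) @ Skip # v)"
proof (induction c arbitrary: u v)
  case (SEQ c d)
  have "srs rules (u @ Skip # map Ins (flatten c) @ map Ins (flatten d) @ v)
      (u @ map Ins (flatten c) @ Skip # map Ins (flatten d) @ v)"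
    by (rule SEQ.IH)
  also have "srs rules \<dots> (u @ map Ins (flatten c) @ map Ins (flatten d) @ Skip # v)"
    using SEQ.IH(2)[of "u @ map Ins (flatten c)" v] by simp
  finally show ?case by simp
next
  case (LOOP i c)
  let ?p = "replicate i RIGHT @ [TEST]"
  let ?w = "map Ins (flatten c) @ Ins CLOSE # v"
  have "srs rules (u @ Skip # Ins OPEN # map Ins ?p @ ?w)
      (u @ Opened False # Skip # map Ins ?p @ ?w)"
    using srs_rule[OF skip_OPEN, of u "map Ins ?p @ ?w"] by simp
  also have "srs rules \<dots> (u @ Opened False # map Ins ?p @ Skip # ?w)"
    using skip_simple[of ?p "u @ [Opened False]" ?w] by auto
  also have "srs rules \<dots> (u @ Opened False # map Ins (?p @ flatten c) @ Skip # Ins CLOSE # v)"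
    using LOOP.IH[of "u @ Opened False # map Ins ?p" "Ins CLOSE # v"] by simp
  also have "srs rules \<dots> (u @ Ins OPEN # map Ins (?p @ flatten c) @ Ins CLOSE # Skip # v)"
    using skip_CLOSE_opened[of u False "?p @ flatten c" v] by simp
  finally show ?case by simp
next
  case (INC i)
  show ?case
    using skip_simple[of "flatten (INC i)" u v] by simp
next
  case FAIL
  show ?case
    using skip_simple[of "[FAILS]" u v] by simp
qed simp

text \<open>Executed text is restored letter by letter, so that \<open>Back\<close> can return over
  it, and the head is home between commands. The prefix \<open>u\<close> is arbitrary because it
  contains the marks of enclosing loops.\<close>

lemma run_flatten:
  assumes "exec c s s'" "regs_below n c" "0 < n"
  shows "srs rules (u @ Run # map Ins (flatten c @ v) @ Bound # tape 0 s n)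
    (u @ map Ins (flatten c) @ Run # map Ins v @ Bound # tape 0 s' n)"
  using assms
proof (induction arbitrary: u v rule: exec.induct)
  case (exec_INC i s)
  have "srs rules (u @ Run # map Ins (flatten (INC i) @ v) @ Bound # tape 0 s n)
      (u @ map Ins (replicate i RIGHT) @ Run # Ins INCR # map Ins v @ Bound # tape i s n)"
    using run_RIGHTs[of 0 i n u "INCR # v" s] exec_INC by simp
  also have "srs rules \<dots> (u @ map Ins (flatten (INC i)) @ Run # map Ins v @ Bound
      # tape 0 (s(i := Suc (s i))) n)"
    using run_INCR[of i n "u @ map Ins (replicate i RIGHT)" v s] exec_INC by simp
  finally show ?case .
next
  case (exec_SEQ c s s' d s'')
  have "srs rules (u @ Run # map Ins (flatten (SEQ c d) @ v) @ Bound # tape 0 s n)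
      (u @ map Ins (flatten c) @ Run # map Ins (flatten d @ v) @ Bound # tape 0 s' n)"
    using exec_SEQ.IH(1)[of u "flatten d @ v"] exec_SEQ.prems by simp
  also have "srs rules \<dots> (u @ map Ins (flatten (SEQ c d)) @ Run # map Ins v @ Bound # tape 0 s'' n)"
    using exec_SEQ.IH(2)[of "u @ map Ins (flatten c)" v] exec_SEQ.prems by simp
  finally show ?case .
next
  case (exec_LOOP_0 s i c)
  let ?w = "map Ins v @ Bound # tape 0 s n"
  have "srs rules (u @ Run # map Ins (flatten (LOOP i c) @ v) @ Bound # tape 0 s n)
      (u @ Opened True # Run # map Ins (replicate i RIGHT @ TEST # flatten c @ CLOSE # v)
        @ Bound # tape 0 s n)"
    using srs_rule[OF run_OPEN, of u] by fastforce
  also have "srs rules \<dots> (u @ Opened True # map Ins (replicate i RIGHT)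
      @ Run # Ins TEST # map Ins (flatten c @ CLOSE # v) @ Bound # tape i s n)"
    using run_RIGHTs[of 0 i n "u @ [Opened True]" "TEST # flatten c @ CLOSE # v" s] exec_LOOP_0 by simp
  also have "srs rules \<dots> (u @ Opened True # map Ins (replicate i RIGHT)
      @ Ins TEST # Skip # map Ins (flatten c @ CLOSE # v) @ Bound # tape 0 s n)"
    using run_TEST_zero[of i n s "u @ Opened True # map Ins (replicate i RIGHT)" "flatten c @ CLOSE # v"]
      exec_LOOP_0 by simp
  also have "srs rules \<dots> (u @ Opened True # map Ins (replicate i RIGHT @ TEST # flatten c)
      @ Skip # Ins CLOSE # ?w)"
    using skip_flatten[of "u @ Opened True # map Ins (replicate i RIGHT @ [TEST])" c "Ins CLOSE # ?w"]
    by simp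
  also have "srs rules \<dots> (u @ map Ins (flatten (LOOP i c)) @ Run # ?w)"
    using skip_CLOSE_opened[of u True "replicate i RIGHT @ TEST # flatten c" ?w] by simp
  finally show ?case .
next
  case (exec_LOOP_Suc s i c s' s'')
  have "srs rules (u @ Run # map Ins (flatten (LOOP i c) @ v) @ Bound # tape 0 s n)
      (u @ Opened True # Run # map Ins (replicate i RIGHT @ TEST # flatten c @ CLOSE # v)
        @ Bound # tape 0 s n)"
    using srs_rule[OF run_OPEN, of u] by fastforce
  also have "srs rules \<dots> (u @ Opened True # map Ins (replicate i RIGHT)
      @ Run # Ins TEST # map Ins (flatten c @ CLOSE # v) @ Bound # tape i s n)"
    using run_RIGHTs[of 0 i n "u @ [Opened True]" "TEST # flatten c @ CLOSE # v" s] exec_LOOP_Suc by simp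
  also have "srs rules \<dots> (u @ Opened True # map Ins (replicate i RIGHT)
      @ Ins TEST # Run # map Ins (flatten c @ CLOSE # v) @ Bound # tape 0 (s(i := s i - 1)) n)"
    using run_TEST_nonzero[of i n s "u @ Opened True # map Ins (replicate i RIGHT)" "flatten c @ CLOSE # v"]
      exec_LOOP_Suc by simp
  also have "srs rules \<dots> (u @ Opened True # map Ins (replicate i RIGHT @ TEST # flatten c)
      @ Run # Ins CLOSE # map Ins v @ Bound # tape 0 s' n)"
    using exec_LOOP_Suc.IH(1)[of "u @ Opened True # map Ins (replicate i RIGHT @ [TEST])" "CLOSE # v"]
      exec_LOOP_Suc.prems by (simp add: fun_upd_def)
  also have "srs rules \<dots> (u @ Opened True # map Ins (replicate i RIGHT @ TEST # flatten c)
      @ Back # Ins CLOSE # map Ins v @ Bound # tape 0 s' n)"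
    using srs_rule[OF run_CLOSE, of "u @ Opened True # map Ins (replicate i RIGHT @ TEST # flatten c)"
        "map Ins v @ Bound # tape 0 s' n"] by simp
  also have "srs rules \<dots> (u @ Opened True # Back # map Ins (replicate i RIGHT @ TEST # flatten c)
      @ Ins CLOSE # map Ins v @ Bound # tape 0 s' n)"
    using srs_left[of "map Ins (replicate i RIGHT @ TEST # flatten c)" Back rules "u @ [Opened True]"
        "Ins CLOSE # map Ins v @ Bound # tape 0 s' n"] back_move by fastforce
  also have "srs rules \<dots> (u @ Run # map Ins (flatten (LOOP i c) @ v) @ Bound # tape 0 s' n)"
    using srs_rule[OF back_open, of u] by fastforce
  also have "srs rules \<dots> (u @ map Ins (flatten (LOOP i c)) @ Run # map Ins v @ Bound # tape 0 s'' n)"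
    using exec_LOOP_Suc by blast
  finally show ?case .
qed simp

text \<open>Reachability needs one target word for all inputs, so program and tape are erased at the
  end.\<close>

lemma run_end_Halt: "srs rules (LEnd # map Ins p @ Run # Bound # tape h s n) [Halt]"
proof -
  have eat: "srs rules (u @ EatR # w @ [REnd]) (u @ [EatR, REnd])" if "set w \<subseteq> {Cell, Head, One}" for u w
    using that
  proof (induction w)
    case (Cons a w)
    have "srs rules (u @ EatR # (a # w) @ [REnd]) (u @ EatR # w @ [REnd])"
      using srs_rule[OF eatR, of a u "w @ [REnd]"] Cons.prems by simp
    also have "srs rules \<dots> (u @ [EatR, REnd])"
      using Cons by simp
    finally show ?case .
  qed simp
  have eat': "srs rules (LEnd # map Ins p @ [EatL]) [LEnd, EatL]" for p
  proof (induction p rule: rev_induct)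
    case (snoc i p)
    have "srs rules (LEnd # map Ins (p @ [i]) @ [EatL]) (LEnd # map Ins p @ [EatL])"
      using srs_rule[OF eatL, of "LEnd # map Ins p" i "[]"] by simp
    also have "srs rules \<dots> [LEnd, EatL]"
      by (rule snoc)
    finally show ?case .
  qed simp
  let ?t = "cells s 0 h @ Head # replicate (s h) One @ cells s (Suc h) n"
  let ?u = "LEnd # map Ins p"
  have "srs rules (LEnd # map Ins p @ Run # Bound # tape h s n) (?u @ EatR # ?t @ [REnd])"
    using srs_rule[OF run_end, of ?u "tape h s n"] by (simp add: tape_def)
  also have "srs rules \<dots> (?u @ [EatR, REnd])"
    using set_cells by (intro eat) fastforce
  also have "srs rules \<dots> (LEnd # map Ins p @ [EatL])"
    using srs_rule[OF eatR_end, of ?u "[]"] by simp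
  also have "srs rules \<dots> [LEnd, EatL]"
    by (rule eat')
  also have "srs rules \<dots> [Halt]"
    using srs_rule[OF eatL_end, of "[]" "[]"] by simp
  finally show ?thesis .
qed

lemma one_active_run: "one_active (LEnd # map Ins p @ Run # map Ins v @ Bound # tape h s n)"
proof -
  have "filter active (cells s j k) = []" for j k
    using set_cells[of s j k] by (auto simp: filter_empty_conv active_def)
  then show ?thesis
    by (simp add: one_active_def tape_def active_def filter_replicate filter_map comp_def)
qed

lemma one_active_srs: "srs rules w x \<Longrightarrow> one_active w \<Longrightarrow> one_active x"
  by (induction rule: rtranclp_induct) (auto intro: one_active_step)

text \<open>\<open>LOOP r FAIL\<close> is passed over exactly when register \<open>r\<close> is
  zero; otherwise the run sticks at \<open>FAILS\<close>, and by determinism it cannot also reach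
  \<open>[Halt]\<close>.\<close>

lemma run_program_Halt_iff:
  assumes "exec c s s'" "regs_below n c" "r < n"
  shows "srs rules (LEnd # Run # map Ins (replicate k NOP @ flatten (SEQ c (LOOP r FAIL)))
    @ Bound # tape 0 s n) [Halt] \<longleftrightarrow> s' r = 0"
proof -
  let ?w = "LEnd # Run # map Ins (replicate k NOP @ flatten (SEQ c (LOOP r FAIL))) @ Bound # tape 0 s n"
  let ?u = "LEnd # map Ins (replicate k NOP @ flatten c)"
  have "([Run, a], [a, Run]) \<in> rules" if "a \<in> set (map Ins (replicate k NOP))" for a
    using that run_NOP by auto
  then have "srs rules ?w (LEnd # map Ins (replicate k NOP) @ Run
      # map Ins (flatten c @ flatten (LOOP r FAIL)) @ Bound # tape 0 s n)"
    using srs_right[of "map Ins (replicate k NOP)" Run rules "[LEnd]"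
        "map Ins (flatten c @ flatten (LOOP r FAIL)) @ Bound # tape 0 s n"] by simp
  also have "srs rules \<dots> (?u @ Run # map Ins (flatten (LOOP r FAIL)) @ Bound # tape 0 s' n)"
    using run_flatten[OF assms(1,2), of "LEnd # map Ins (replicate k NOP)" "flatten (LOOP r FAIL)"]
      assms(3) by simp
  finally have start: "srs rules ?w (?u @ Run # map Ins (flatten (LOOP r FAIL)) @ Bound # tape 0 s' n)" .
  show ?thesis
  proof
    assume 0: "s' r = 0"
    note start
    also have "srs rules (?u @ Run # map Ins (flatten (LOOP r FAIL)) @ Bound # tape 0 s' n)
        (?u @ map Ins (flatten (LOOP r FAIL)) @ Run # Bound # tape 0 s' n)"
      using run_flatten[OF exec_LOOP_0, of s' r n FAIL ?u "[]"] 0 assms(3) by simp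
    also have "srs rules \<dots> [Halt]"
      using run_end_Halt[of "replicate k NOP @ flatten c @ flatten (LOOP r FAIL)" 0 s' n] by simp
    finally show "srs rules ?w [Halt]" .
  next
    assume halt: "srs rules ?w [Halt]"
    show "s' r = 0"
    proof (rule ccontr)
      assume pos: "s' r \<noteq> 0"
      let ?p = "?u @ Opened True # map Ins (replicate r RIGHT) @ [Ins TEST]"
      let ?t = "Ins CLOSE # Bound # tape 0 (s'(r := s' r - 1)) n"
      note start
      also have "srs rules (?u @ Run # map Ins (flatten (LOOP r FAIL)) @ Bound # tape 0 s' n)
          (?u @ Opened True # Run # map Ins (replicate r RIGHT @ [TEST, FAILS, CLOSE])
            @ Bound # tape 0 s' n)"
        using srs_rule[OF run_OPEN, of ?u] by fastforce
      also have "srs rules \<dots> (?u @ Opened True # map Ins (replicate r RIGHT)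
          @ Run # map Ins [TEST, FAILS, CLOSE] @ Bound # tape r s' n)"
        using run_RIGHTs[of 0 r n "?u @ [Opened True]" "[TEST, FAILS, CLOSE]" s'] assms(3) by simp
      also have "srs rules \<dots> (?p @ Run # Ins FAILS # ?t)"
        using run_TEST_nonzero[of r n s' "?u @ Opened True # map Ins (replicate r RIGHT)"
            "[FAILS, CLOSE]"] assms(3) pos by simp
      finally have stuck: "srs rules ?w (?p @ Run # Ins FAILS # ?t)" .
      have active: "one_active ?w"
        using one_active_run[of "[]" "replicate k NOP @ flatten (SEQ c (LOOP r FAIL))" 0 s n]
        by (simp only: list.map append.simps)
      have "one_active (?p @ Run # Ins FAILS # ?t)"
        by (rule one_active_srs[OF stuck active])
      from rules_unique_normal_form[OF halt stuck active Halt_irreducible FAILS_irreducible[OF this]]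
      show False by simp
    qed
  qed
qed

section \<open>Ambiguity of products of tiles\<close>

definition post_solvable :: "('a list \<times> 'a list) set \<Rightarrow> 'a list \<Rightarrow> 'a list \<Rightarrow> bool" where
  "post_solvable Q w z \<longleftrightarrow>
     (\<exists>qs. set qs \<subseteq> Q \<and> w @ concat (map snd qs) = concat (map fst qs) @ z)"

text \<open>The letter \<open>None\<close> separates the successive words of a derivation.\<close>

definition srs_pairs :: "('a list \<times> 'a list) set \<Rightarrow> ('a option list \<times> 'a option list) set" where
  "srs_pairs R = range (\<lambda>a. ([a], [a])) \<union> (\<lambda>(l, r). (map Some l, map Some r)) ` R"

lemma map_Some_None_eq:
  "map Some v @ None # x = map Some w @ None # y \<longleftrightarrow> v = w \<and> x = y"
proof (induction v arbitrary: w)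
  case Nil
  then show ?case by (cases w) auto
next
  case (Cons a v)
  then show ?case by (cases w) auto
qed

lemma srs_append: "srs R x x' \<Longrightarrow> srs R y y' \<Longrightarrow> srs R (x @ y) (x' @ y')"
  using srs_context[of R x x' "[]" y] srs_context[of R y y' x' "[]"] by simp

text \<open>Between separators the pairs copy letters and apply rules at disjoint places; such
  parallel rewriting is compatible with concatenation.\<close>

lemma srs_pairs_without_separator:
  assumes "set qs \<subseteq> srs_pairs R" "([None], [None]) \<notin> set qs"
  shows "\<exists>a b. concat (map fst qs) = map Some a \<and> concat (map snd qs) = map Some b \<and> srs R a b"
  using assms
proof (induction qs)
  case (Cons q qs)
  from Cons.IH Cons.prems obtain a b
    where ab: "concat (map fst qs) = map Some a" "concat (map snd qs) = map Some b" "srs R a b"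
    by auto
  from Cons.prems have "q \<in> srs_pairs R" "q \<noteq> ([None], [None])"
    by auto
  then consider a' where "q = ([Some a'], [Some a'])"
    | l r where "(l, r) \<in> R" "q = (map Some l, map Some r)"
    unfolding srs_pairs_def by (auto simp: image_iff) (metis not_None_eq)+
  then show ?case
  proof cases
    case 1
    with ab srs_append[of R "[a']" "[a']" a b] show ?thesis
      by (intro exI[of _ "a' # a"] exI[of _ "a' # b"]) auto
  next
    case 2
    with ab srs_append[of R l r a b] srs_rule[of l r R "[]" "[]"] show ?thesis
      by (intro exI[of _ "l @ a"] exI[of _ "r @ b"]) auto
  qed
qed auto

text \<open>The pairs before the first separator must spell \<open>w\<close> on the left, since
  \<open>w\<close> has no \<open>None\<close>; their right sides give the next word, from which the
  shorter remainder is again a solution.\<close>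

lemma srs_if_post_solvable:
  assumes "set qs \<subseteq> srs_pairs R"
    "(map Some w @ [None]) @ concat (map snd qs) = concat (map fst qs) @ map Some z @ [None]"
  shows "srs R w z"
  using assms
proof (induction "length qs" arbitrary: qs w rule: less_induct)
  case less
  show ?case
  proof (cases "([None], [None]) \<in> set qs")
    case True
    then obtain qs1 qs2 where qs: "qs = qs1 @ ([None], [None]) # qs2" "([None], [None]) \<notin> set qs1"
      by (meson split_list_first)
    with less.prems(1) srs_pairs_without_separator[of qs1 R] obtain a b
      where ab: "concat (map fst qs1) = map Some a" "concat (map snd qs1) = map Some b" "srs R a b"
      by auto
    have eq: "w = a" "(map Some b @ [None]) @ concat (map snd qs2)
        = concat (map fst qs2) @ map Some z @ [None]"
      using less.prems(2) by (simp_all add: qs ab map_Some_None_eq)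
    have "srs R b z"
      using less.hyps[OF _ _ eq(2)] less.prems(1) qs by simp
    with ab(3) eq(1) show ?thesis
      by simp
  next
    case False
    with less.prems(1) srs_pairs_without_separator[of qs R] obtain a b
      where ab: "concat (map fst qs) = map Some a" "concat (map snd qs) = map Some b" "srs R a b"
      by auto
    \<comment> \<open>Each side contains a single \<open>None\<close>, so nothing can follow it:
      \<open>b\<close> is empty and \<open>z\<close> is the unread end of \<open>w\<close>.\<close>
    have "map Some w @ None # map Some b = map Some (a @ z) @ None # []"
      using less.prems(2) by (simp add: ab)
    then have "w = a @ z" "b = []"
      unfolding map_Some_None_eq by auto
    with ab(3) srs_append[of R a b z z] show ?thesis
      by simp
  qed
qed

lemma post_solvable_if_srs:
  "srs R w z \<Longrightarrow> post_solvable (srs_pairs R) (map Some w @ [None]) (map Some z @ [None])"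
proof (induction rule: converse_rtranclp_induct)
  case base
  show ?case
    unfolding post_solvable_def by (intro exI[of _ "[]"]) simp
next
  case (step w w')
  from step.hyps(1) obtain u v l r where R: "(l, r) \<in> R" "w = u @ l @ v" "w' = u @ r @ v"
    by (auto simp: srs_step_def)
  from step.IH obtain qs where qs: "set qs \<subseteq> srs_pairs R"
    "(map Some w' @ [None]) @ concat (map snd qs) = concat (map fst qs) @ map Some z @ [None]"
    by (auto simp: post_solvable_def)
  define copy :: "'a list \<Rightarrow> ('a option list \<times> 'a option list) list"
    where "copy = map (\<lambda>a. ([Some a], [Some a]))"
  have copy: "concat (map fst (copy x)) = map Some x" "concat (map snd (copy x)) = map Some x"
    "set (copy x) \<subseteq> srs_pairs R" for x
    by (induction x) (auto simp: copy_def srs_pairs_def)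
  have "([None], [None]) \<in> srs_pairs R" "(map Some l, map Some r) \<in> srs_pairs R"
    using R(1) by (auto simp: srs_pairs_def)
  then show ?case
    unfolding post_solvable_def using qs copy R
    by (intro exI[of _ "copy u @ (map Some l, map Some r) # copy v @ ([None], [None]) # qs"]) auto
qed

lemma srs_iff_post_solvable:
  "srs R w z \<longleftrightarrow> post_solvable (srs_pairs R) (map Some w @ [None]) (map Some z @ [None])"
  using post_solvable_if_srs srs_if_post_solvable unfolding post_solvable_def by blast

section \<open>Tiles and their factorizations\<close>

datatype 'a letter = Hash | Beg | Fin | Ltr 'a

datatype 'a tile = Start | Stop | Tile "'a list" "'a list"

definition hash_after :: "'a list \<Rightarrow> 'a letter list" where
  "hash_after w = concat (map (\<lambda>a. [Ltr a, Hash]) w)"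

definition hash_before :: "'a list \<Rightarrow> 'a letter list" where
  "hash_before w = concat (map (\<lambda>a. [Hash, Ltr a]) w)"

text \<open>The Boolean chooses the side of the equation: \<open>True\<close> spells the initial
  word and the right-hand sides, \<open>False\<close> the left-hand sides and the final word.
  \<open>Start\<close> gives the \<open>True\<close> side its lead, which \<open>Stop\<close> makes
  up on the \<open>False\<close> side.\<close>

fun piece :: "'a list \<Rightarrow> 'a list \<Rightarrow> 'a tile \<times> bool \<Rightarrow> 'a letter list" where
  "piece w z (Start, b) = (if b then Beg # Hash # hash_after w else [Beg])"
| "piece w z (Stop, b) = (if b then [Fin] else hash_before z @ [Hash, Fin])"
| "piece w z (Tile l r, b) = (if b then hash_after r else hash_before l)"

definition tiles :: "('a list \<times> 'a list) set \<Rightarrow> 'a tile set" where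
  "tiles Q = {Start, Stop} \<union> (\<lambda>(l, r). Tile l r) ` Q"

text \<open>
  The two sides of a partial solution are told apart by the first place where the alternation of
  \<open>Hash\<close> with other letters breaks: on the one side it cannot be a double \<open>Hash\<close>, on the other side
  it cannot be a pair of letters, regardless of what follows. The Boolean argument says whether the
  preceding letter is \<open>Hash\<close>.
\<close>

fun no_double_hash :: "bool \<Rightarrow> 'a letter list \<Rightarrow> bool" where
  "no_double_hash h [] = True"
| "no_double_hash h (x # w) =
     (if x = Hash then \<not> h \<and> no_double_hash True w else h \<longrightarrow> no_double_hash False w)"

fun no_double_letter :: "bool \<Rightarrow> 'a letter list \<Rightarrow> bool" where
  "no_double_letter h [] = True"
| "no_double_letter h (x # w) =
     (if x = Hash then h \<or> no_double_letter True w
      else h \<and> (x \<in> range Ltr \<longrightarrow> no_double_letter False w))"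

lemma hash_simps [simp]:
  "hash_before [] = []" "hash_before (a # w) = Hash # Ltr a # hash_before w"
  "hash_before (v @ w) = hash_before v @ hash_before w"
  "hash_after [] = []" "hash_after (a # w) = Ltr a # Hash # hash_after w"
  "hash_after (v @ w) = hash_after v @ hash_after w"
  by (auto simp: hash_before_def hash_after_def)

lemma Hash_hash_after: "Hash # hash_after w = hash_before w @ [Hash]"
  by (induction w) auto

lemma length_hash_before: "length (hash_before w) = 2 * length w"
  by (induction w) auto

lemma no_double_hash_before: "no_double_hash False (hash_before w @ x) = no_double_hash False x"
  by (induction w) auto

lemma no_double_letter_before: "no_double_letter False (hash_before w @ x) = no_double_letter False x"
  by (induction w) auto

lemma no_double_letter_after: "no_double_letter True (hash_after w @ x) = no_double_letter True x"
  by (induction w) auto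

text \<open>After a letter, a piece that begins with a letter settles the check at once; the others
  consist of pairs of \<open>Hash\<close> and a letter and return to the same state.\<close>

lemma no_double_hash_pieces: "no_double_hash False (concat (map (piece w z) ks))"
proof (induction ks)
  case (Cons k ks)
  obtain i b where k: "k = (i, b)" by force
  show ?case
  proof (cases i)
    case (Tile l r)
    with Cons show ?thesis
      by (cases r) (auto simp: k no_double_hash_before)
  qed (use Cons in \<open>auto simp: k no_double_hash_before\<close>)
qed simp

text \<open>Dually, after \<open>Hash\<close> the check is settled by a piece that begins with
  \<open>Hash\<close>, and also by \<open>Beg\<close> and \<open>Fin\<close>; the others consist of
  pairs of a letter and \<open>Hash\<close>.\<close>

lemma no_double_letter_pieces: "no_double_letter True (concat (map (piece w z) ks))"
proof (induction ks)
  case (Cons k ks)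
  obtain i b where k: "k = (i, b)" by force
  show ?case
  proof (cases i)
    case Stop
    with Cons show ?thesis
      by (cases z) (auto simp: k)
  next
    case (Tile l r)
    with Cons show ?thesis
      by (cases l) (auto simp: k no_double_letter_after)
  qed (use Cons in \<open>auto simp: k\<close>)
qed simp

lemma hash_before_Fin_eq:
  "hash_before v @ Hash # Fin # x = hash_before w @ Hash # Fin # y \<Longrightarrow> v = w"
proof (induction v arbitrary: w)
  case Nil
  then show ?case by (cases w) auto
next
  case (Cons a v)
  then show ?case by (cases w) auto
qed

context
  fixes Q :: "('a list \<times> 'a list) set" and w z :: "'a list"
  assumes nonempty: "\<forall>(l, r)\<in>Q. l \<noteq> [] \<and> r \<noteq> []"
begin

lemma piece_True_Cons: "i \<in> tiles Q \<Longrightarrow> \<exists>x t. piece w z (i, True) = x # t \<and> x \<noteq> Hash"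
  using nonempty by (fastforce simp: tiles_def neq_Nil_conv)

lemma piece_False_Cons: "i \<in> tiles Q \<Longrightarrow> i \<noteq> Start \<Longrightarrow> \<exists>t. piece w z (i, False) = Hash # t"
  using nonempty by (cases z) (fastforce simp: tiles_def neq_Nil_conv)+

text \<open>The side of \<open>xs\<close> has spelled \<open>a\<close> and one more
  \<open>Hash\<close>, that of \<open>ys\<close> has spelled \<open>b\<close>. This shift persists
  and forces every further tile to be used as \<open>True\<close> in \<open>xs\<close> and
  \<open>False\<close> in \<open>ys\<close>, until \<open>Stop\<close> closes the equation.\<close>

lemma solution_from_overlap:
  assumes "map fst xs = map fst ys" "fst ` set xs \<subseteq> tiles Q"
    "hash_before a @ Hash # concat (map (piece w z) xs) = hash_before b @ concat (map (piece w z) ys)"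
  shows "\<exists>qs. set qs \<subseteq> Q \<and> a @ concat (map snd qs) = b @ concat (map fst qs) @ z"
  using assms
proof (induction xs arbitrary: ys a b)
  case Nil
  then have "length (hash_before a @ [Hash]) = length (hash_before b)"
    by simp
  \<comment> \<open>The extra \<open>Hash\<close> is a difference of parity, so the products cannot
    end before \<open>Stop\<close>.\<close>
  then have "Suc (2 * length a) = 2 * length b"
    by (simp add: length_hash_before)
  then have False
    by presburger
  then show ?case ..
next
  case (Cons k xs)
  obtain i p where k: "k = (i, p)" by force
  with Cons.prems(1) obtain q ys' where ys: "ys = (i, q) # ys'" "map fst xs = map fst ys'"
    by (cases ys) auto
  have i: "i \<in> tiles Q"
    using Cons.prems(2) k by simp
  let ?X = "concat (map (piece w z) xs)" and ?Y = "concat (map (piece w z) ys')"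
  have eq: "hash_before a @ Hash # piece w z (i, p) @ ?X = hash_before b @ piece w z (i, q) @ ?Y"
    using Cons.prems(3) by (simp add: k ys)
  \<comment> \<open>A \<open>False\<close> piece in \<open>xs\<close> would give a double
    \<open>Hash\<close>, which the side of \<open>ys\<close> cannot contain that early.\<close>
  have "\<not> (i \<noteq> Start \<and> \<not> p)"
  proof
    assume "i \<noteq> Start \<and> \<not> p"
    with piece_False_Cons[OF i] obtain t where "piece w z (i, p) = Hash # t"
      by auto
    then have "\<not> no_double_hash False (hash_before a @ Hash # piece w z (i, p) @ ?X)"
      by (simp add: no_double_hash_before)
    moreover have "no_double_hash False (hash_before b @ piece w z (i, q) @ ?Y)"
      using no_double_hash_pieces[of w z ys] by (simp add: no_double_hash_before ys)
    ultimately show False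
      using eq by metis
  qed
  \<comment> \<open>A piece of \<open>ys\<close> beginning with a letter would give two adjacent
    letters, which the side of \<open>xs\<close> cannot contain that early.\<close>
  moreover have "\<not> (i = Start \<or> q)"
  proof
    assume "i = Start \<or> q"
    with piece_True_Cons[OF i] obtain x t where "piece w z (i, q) = x # t" "x \<noteq> Hash"
      by (cases q) auto
    then have "\<not> no_double_letter False (hash_before b @ piece w z (i, q) @ ?Y)"
      by (simp add: no_double_letter_before)
    moreover have "no_double_letter False (hash_before a @ Hash # piece w z (i, p) @ ?X)"
      using no_double_letter_pieces[of w z "k # xs"] by (simp add: no_double_letter_before k)
    ultimately show False
      using eq by metis
  qed
  ultimately have pq: "i \<noteq> Start" p "\<not> q"
    by auto
  show ?case
  proof (cases i)
    case Stop
    \<comment> \<open>\<open>Fin\<close> is no \<open>Ltr\<close>, so its first occurrence marks the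
      end of the common word, whatever follows.\<close>
    then have "hash_before a @ Hash # Fin # ?X = hash_before (b @ z) @ Hash # Fin # ?Y"
      using eq pq by simp
    from hash_before_Fin_eq[OF this] show ?thesis
      by (intro exI[of _ "[]"]) simp
  next
    case (Tile l r)
    then have Q: "(l, r) \<in> Q"
      using i by (auto simp: tiles_def)
    have "hash_before (a @ r) @ Hash # ?X = hash_before a @ (Hash # hash_after r) @ ?X"
      by (simp add: Hash_hash_after)
    also have "\<dots> = hash_before (b @ l) @ ?Y"
      using eq pq Tile by simp
    finally obtain qs where "set qs \<subseteq> Q" "(a @ r) @ concat (map snd qs) = (b @ l) @ concat (map fst qs) @ z"
      using Cons.IH[OF ys(2), of "a @ r" "b @ l"] Cons.prems(2) by auto
    with Q show ?thesis
      by (intro exI[of _ "(l, r) # qs"]) auto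
  qed (use pq in simp)
qed

text \<open>After cancelling common pieces, one tile occurs in both versions. These differ in
  whether they begin with \<open>Hash\<close>, except for \<open>Start\<close>, which creates the
  shift of \<open>solution_from_overlap\<close>.\<close>

lemma post_solvable_if_ambiguous:
  assumes "map fst xs = map fst ys" "fst ` set xs \<subseteq> tiles Q"
    "concat (map (piece w z) xs) = concat (map (piece w z) ys)" "xs \<noteq> ys"
  shows "post_solvable Q w z"
  using assms
proof (induction xs arbitrary: ys)
  case (Cons k xs)
  obtain i p where k: "k = (i, p)" by force
  with Cons.prems(1) obtain q ys' where ys: "ys = (i, q) # ys'" "map fst xs = map fst ys'"
    by (cases ys) auto
  have i: "i \<in> tiles Q"
    using Cons.prems(2) k by simp
  have start: "post_solvable Q w z"
    if "map fst us = map fst vs" "fst ` set us \<subseteq> tiles Q"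
      "piece w z (i, True) @ concat (map (piece w z) us) = piece w z (i, False) @ concat (map (piece w z) vs)"
    for us vs
  proof (cases "i = Start")
    case True
    then have "hash_before w @ Hash # concat (map (piece w z) us)
        = hash_before [] @ concat (map (piece w z) vs)"
      using that(3) Hash_hash_after[of w] by simp
    from solution_from_overlap[OF that(1,2) this] show ?thesis
      by (simp add: post_solvable_def)
  next
    case False
    obtain x t t' where "piece w z (i, True) = x # t" "x \<noteq> Hash" "piece w z (i, False) = Hash # t'"
      using piece_True_Cons[OF i] piece_False_Cons[OF i False] by blast
    with that(3) show ?thesis
      by simp
  qed
  show ?case
  proof (cases "p = q")
    case True
    have "post_solvable Q w z"
      if "fst ` set xs \<subseteq> tiles Q" "concat (map (piece w z) xs) = concat (map (piece w z) ys')" "xs \<noteq> ys'"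
      using Cons.IH[OF ys(2) that] .
    with Cons.prems(2-) True show ?thesis
      by (simp add: k ys)
  next
    case False
    have tiles: "fst ` set xs \<subseteq> tiles Q" "fst ` set ys' \<subseteq> tiles Q"
      using Cons.prems(2) arg_cong[OF ys(2), of set] k by auto
    have eq: "piece w z (i, p) @ concat (map (piece w z) xs) = piece w z (i, q) @ concat (map (piece w z) ys')"
      using Cons.prems(3) by (simp add: k ys)
    show ?thesis
    proof (cases p)
      case True
      with False eq show ?thesis
        by (intro start[OF ys(2) tiles(1)]) simp
    next
      case p: False
      with False eq show ?thesis
        by (intro start[OF ys(2)[symmetric] tiles(2)]) simp
    qed
  qed
qed simp

lemma ambiguous_if_post_solvable:
  assumes "post_solvable Q w z"
  shows "\<exists>xs ys. xs \<noteq> ys \<and> fst ` set xs \<subseteq> tiles Q \<and> map fst xs = map fst ys \<and>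
    concat (map (piece w z) xs) = concat (map (piece w z) ys)"
proof -
  from assms obtain qs where qs: "set qs \<subseteq> Q" "w @ concat (map snd qs) = concat (map fst qs) @ z"
    by (auto simp: post_solvable_def)
  define ks where "ks b = (Start, b) # map (\<lambda>(l, r). (Tile l r, b)) qs @ [(Stop, b)]" for b :: bool
  have after: "concat (map (piece w z) (map (\<lambda>(l, r). (Tile l r, True)) qs)) = hash_after (concat (map snd qs))"
    by (induction qs) auto
  have before: "concat (map (piece w z) (map (\<lambda>(l, r). (Tile l r, False)) qs)) = hash_before (concat (map fst qs))"
    by (induction qs) auto
  have "concat (map (piece w z) (ks True)) = Beg # (Hash # hash_after (w @ concat (map snd qs))) @ [Fin]"
    using after by (simp add: ks_def)
  also have "\<dots> = Beg # hash_before (concat (map fst qs) @ z) @ [Hash, Fin]"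
    unfolding Hash_hash_after qs(2) by simp
  also have "\<dots> = concat (map (piece w z) (ks False))"
    using before by (simp add: ks_def)
  finally have "concat (map (piece w z) (ks True)) = concat (map (piece w z) (ks False))" .
  moreover have "map fst (ks True) = map fst (ks False)" "ks True \<noteq> ks False"
    by (auto simp: ks_def)
  moreover have "fst ` set (ks True) \<subseteq> tiles Q"
    using qs(1) by (force simp: ks_def tiles_def)
  ultimately show ?thesis
    by blast
qed

text \<open>Makes distinct indices give distinct generators, so that factorizations correspond to
  sequences of indices.\<close>

lemma piece_neq: "i \<in> tiles Q \<Longrightarrow> piece w z (i, True) \<noteq> piece w z (i, False)"
  using piece_True_Cons[of i] piece_False_Cons[of i] by (cases "i = Start") auto

end

section \<open>Binary codes, and freeness as injectivity\<close>

text \<open>A prefix code with \<open>False\<close> as terminator, so any finite alphabet fits into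
  binary words.\<close>

definition block_code :: "('a \<Rightarrow> nat) \<Rightarrow> 'a list \<Rightarrow> bool list" where
  "block_code f w = concat (map (\<lambda>a. replicate (f a) True @ [False]) w)"

lemma block_code_append: "block_code f (v @ w) = block_code f v @ block_code f w"
  by (simp add: block_code_def)

lemma replicate_separator_eq:
  "replicate m True @ False # x = replicate n True @ False # y \<Longrightarrow> m = n \<and> x = y"
proof (induction m arbitrary: n)
  case 0
  then show ?case by (cases n) auto
next
  case (Suc m)
  then show ?case by (cases n) auto
qed

lemma block_code_eqD:
  assumes "inj_on f A" "set v \<subseteq> A" "set w \<subseteq> A" "block_code f v = block_code f w"
  shows "v = w"
  using assms(2-)
proof (induction v arbitrary: w)
  case Nil
  then show ?case by (cases w) (auto simp: block_code_def)
next
  case (Cons a v)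
  then obtain b w' where w: "w = b # w'"
    by (cases w) (auto simp: block_code_def)
  have "f a = f b" "block_code f v = block_code f w'"
    using Cons.prems(3) replicate_separator_eq[of "f a" "block_code f v" "f b" "block_code f w'"]
    by (simp_all add: block_code_def w)
  moreover have "v = w'"
    using Cons.IH[OF _ _ calculation(2)] Cons.prems(1,2) by (simp add: w)
  moreover have "a = b"
    using inj_onD[OF assms(1) calculation(1)] Cons.prems(1,2) by (simp add: w)
  ultimately show ?case
    by (simp add: w)
qed

lemma list_product_append:
  assumes "Group.monoid M" "set ws \<subseteq> carrier M" "set vs \<subseteq> carrier M"
  shows "list_product M ws \<in> carrier M"
    and "list_product M (vs @ ws) = list_product M vs \<otimes>\<^bsub>M\<^esub> list_product M ws"
proof -
  interpret Group.monoid M by fact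
  have closed: "list_product M us \<in> carrier M" if "set us \<subseteq> carrier M" for us
    using that by (induction us) (auto simp: list_product_def)
  from closed[OF assms(2)] show "list_product M ws \<in> carrier M" .
  show "list_product M (vs @ ws) = list_product M vs \<otimes>\<^bsub>M\<^esub> list_product M ws"
    using assms(3)
  proof (induction vs)
    case Nil
    with closed[OF assms(2)] show ?case
      by (simp add: list_product_def)
  next
    case (Cons a vs)
    with closed[of vs] closed[OF assms(2)] show ?case
      by (simp add: list_product_def m_assoc)
  qed
qed

lemma inj_on_iff_ex1: "inj_on f A \<longleftrightarrow> (\<forall>v\<in>A. \<exists>!w. w \<in> A \<and> f w = f v)"
proof
  assume "inj_on f A"
  then show "\<forall>v\<in>A. \<exists>!w. w \<in> A \<and> f w = f v"
    by (auto intro!: ex1I dest: inj_onD)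
next
  assume ex1: "\<forall>v\<in>A. \<exists>!w. w \<in> A \<and> f w = f v"
  show "inj_on f A"
  proof (rule inj_onI)
    fix v w assume "v \<in> A" "w \<in> A" "f v = f w"
    then show "v = w"
      using bspec[OF ex1 \<open>w \<in> A\<close>] by (elim ex1E) metis
  qed
qed

text \<open>The generated subsemigroup is the image of the non-empty words under
  \<open>list_product\<close>, so unique factorization is injectivity there.\<close>

lemma free_over_iff_inj_on:
  assumes "Group.monoid M" "S \<subseteq> carrier M"
  shows "free_over M S \<longleftrightarrow> inj_on (list_product M) {ws. ws \<noteq> [] \<and> set ws \<subseteq> S}"
proof -
  interpret Group.monoid M by fact
  have single: "list_product M [x] = x" if "x \<in> S" for x
    using that assms(2) by (auto simp: list_product_def)
  have "list_product M ws \<in> subsemigroup_gen M S" if "ws \<noteq> []" "set ws \<subseteq> S" for ws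
    using that
  proof (induction ws rule: list_nonempty_induct)
    case (single x)
    with \<open>\<And>x. x \<in> S \<Longrightarrow> list_product M [x] = x\<close> show ?case
      by (auto intro: subsemigroup_gen.gen)
  next
    case (cons x xs)
    then have "x \<in> subsemigroup_gen M S" "list_product M xs \<in> subsemigroup_gen M S"
      by (auto intro: subsemigroup_gen.gen)
    from subsemigroup_gen.mult[OF this] show ?case
      by (simp add: list_product_def)
  qed
  moreover have "\<exists>ws. ws \<noteq> [] \<and> set ws \<subseteq> S \<and> list_product M ws = x" if "x \<in> subsemigroup_gen M S" for x
    using that
  proof induction
    case (gen s)
    with single show ?case
      by (intro exI[of _ "[s]"]) auto
  next
    case (mult x y)
    then obtain vs ws where "vs \<noteq> []" "set vs \<subseteq> S" "list_product M vs = x"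
      "ws \<noteq> []" "set ws \<subseteq> S" "list_product M ws = y"
      by blast
    with list_product_append(2)[OF assms(1), of ws vs] assms(2) show ?case
      by (intro exI[of _ "vs @ ws"]) auto
  qed
  ultimately have "subsemigroup_gen M S = list_product M ` {ws. ws \<noteq> [] \<and> set ws \<subseteq> S}"
    by blast
  then have "free_over M S \<longleftrightarrow> (\<forall>vs\<in>{ws. ws \<noteq> [] \<and> set ws \<subseteq> S}.
      \<exists>!ws. ws \<noteq> [] \<and> set ws \<subseteq> S \<and> list_product M ws = list_product M vs)"
    by (simp add: free_over_def)
  also have "\<dots> \<longleftrightarrow> inj_on (list_product M) {ws. ws \<noteq> [] \<and> set ws \<subseteq> S}"
    by (subst inj_on_iff_ex1) (simp add: conj_assoc)
  finally show ?thesis .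
qed

section \<open>Undecidability of freeness\<close>

instance instr :: finite
proof
  have "(UNIV :: instr set) = {NOP, RIGHT, INCR, TEST, OPEN, CLOSE, FAILS}"
    by (auto intro: instr.exhaust)
  then show "finite (UNIV :: instr set)"
    by (metis finite.emptyI finite.insertI)
qed

instance sym :: finite
proof
  have "x \<in> range Ins \<union> range Cur \<union> range Opened \<union> range Msg \<union> range Look \<union> range Home \<union> range Top
      \<union> range Reply \<union> range Resume \<union> {LEnd, Bound, REnd, Cell, Head, One, Run, Skip, Back, Unmark, EatR,
      EatL, Halt}" for x
    by (cases x) auto
  then show "finite (UNIV :: sym set)"
    by (rule finite_subset[OF subsetI]) simp
qed

instance letter :: (finite) finite
proof
  have "x \<in> range Ltr \<union> {Hash, Beg, Fin}" for x :: "'a letter"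
    by (cases x) auto
  then show "finite (UNIV :: 'a letter set)"
    by (rule finite_subset[OF subsetI]) simp
qed

locale word_pair_embedding =
  fixes M :: "('m, 'b) monoid_scheme" and \<phi> :: "bool list \<times> bool list \<Rightarrow> 'm"
  assumes monoid: "Group.monoid M"
    and closed: "\<phi> p \<in> carrier M"
    and one: "\<phi> ([], []) = \<one>\<^bsub>M\<^esub>"
    and mult: "\<phi> (a @ c, b @ d) = \<phi> (a, b) \<otimes>\<^bsub>M\<^esub> \<phi> (c, d)"
    and inj: "inj \<phi>"
begin

text \<open>The first component spells the sequence of tile numbers, which all factorizations of an
  element share; so freeness fails iff two Boolean labellings of one tile sequence spell the same
  word.\<close>

lemma free_over_tiles:
  fixes w z :: "'a list" and Q :: "('a list \<times> 'a list) set" and f :: "'a tile \<Rightarrow> nat" and g :: "'a letter \<Rightarrow> nat"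
  assumes nonempty: "\<forall>(l, r)\<in>Q. l \<noteq> [] \<and> r \<noteq> []"
    and f: "inj_on f (tiles Q)" and g: "inj g"
  defines "\<gamma> \<equiv> \<lambda>k. \<phi> (block_code f [fst k], block_code g (piece w z k))"
  shows "inj_on \<gamma> (tiles Q \<times> UNIV)"
    and "free_over M (\<gamma> ` (tiles Q \<times> UNIV)) \<longleftrightarrow> \<not> post_solvable Q w z"
proof -
  let ?A = "tiles Q \<times> (UNIV :: bool set)"
  have eqD: "map fst xs = map fst ys \<and> concat (map (piece w z) xs) = concat (map (piece w z) ys)"
    if "\<phi> (block_code f (map fst xs), block_code g (concat (map (piece w z) xs)))
      = \<phi> (block_code f (map fst ys), block_code g (concat (map (piece w z) ys)))"
      "set xs \<subseteq> ?A" "set ys \<subseteq> ?A" for xs ys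
  proof -
    have "block_code f (map fst xs) = block_code f (map fst ys)"
      "block_code g (concat (map (piece w z) xs)) = block_code g (concat (map (piece w z) ys))"
      using injD[OF inj that(1)] by auto
    moreover have "set (map fst xs) \<subseteq> tiles Q" "set (map fst ys) \<subseteq> tiles Q"
      using that(2,3) by auto
    ultimately show ?thesis
      using block_code_eqD[OF f] block_code_eqD[OF g] by blast
  qed
  show inj\<gamma>: "inj_on \<gamma> ?A"
  proof (rule inj_onI)
    fix k k' assume k: "k \<in> ?A" "k' \<in> ?A" and eq: "\<gamma> k = \<gamma> k'"
    have "fst k = fst k'" "piece w z k = piece w z k'"
      using eqD[of "[k]" "[k']"] eq k by (auto simp: \<gamma>_def)
    moreover from this have "snd k = snd k'"
      using piece_neq[OF nonempty, of "fst k" w z] k(1)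
      by (metis (full_types) mem_Times_iff prod.collapse)
    ultimately show "k = k'"
      by (simp add: prod_eq_iff)
  qed
  have prod: "list_product M (map \<gamma> ks)
      = \<phi> (block_code f (map fst ks), block_code g (concat (map (piece w z) ks)))" for ks
  proof (induction ks)
    case Nil
    show ?case by (simp add: list_product_def block_code_def one)
  next
    case (Cons k ks)
    have "list_product M (map \<gamma> (k # ks)) = \<gamma> k \<otimes>\<^bsub>M\<^esub> list_product M (map \<gamma> ks)"
      by (simp add: list_product_def)
    also have "\<dots> = \<phi> (block_code f [fst k] @ block_code f (map fst ks),
        block_code g (piece w z k) @ block_code g (concat (map (piece w z) ks)))"
      unfolding Cons.IH mult by (simp only: \<gamma>_def)
    finally show ?case
      by (simp flip: block_code_append)
  qed
  have image: "\<gamma> ` ?A \<subseteq> carrier M"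
    using closed by (auto simp: \<gamma>_def)
  show "free_over M (\<gamma> ` ?A) \<longleftrightarrow> \<not> post_solvable Q w z"
    unfolding free_over_iff_inj_on[OF monoid image]
  proof
    assume inj_prod: "inj_on (list_product M) {ws. ws \<noteq> [] \<and> set ws \<subseteq> \<gamma> ` ?A}"
    show "\<not> post_solvable Q w z"
    proof
      assume "post_solvable Q w z"
      from ambiguous_if_post_solvable[OF nonempty this]
      obtain xs ys where xy: "xs \<noteq> ys" "fst ` set xs \<subseteq> tiles Q" "map fst xs = map fst ys"
        "concat (map (piece w z) xs) = concat (map (piece w z) ys)"
        by blast
      have "fst ` set ys \<subseteq> tiles Q"
        using xy(2) arg_cong[OF xy(3), of set] by simp
      then have A: "set xs \<subseteq> ?A" "set ys \<subseteq> ?A"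
        using xy(2) by auto
      have "xs \<noteq> []" "ys \<noteq> []"
        using xy(1,3) by auto
      then have "map \<gamma> xs = map \<gamma> ys"
        using A xy(3,4) by (intro inj_onD[OF inj_prod]) (auto simp: prod)
      with inj_on_map_eq_map[of \<gamma> xs ys] inj\<gamma> A xy(1) show False
        using inj_on_subset[OF inj\<gamma>] by simp
    qed
  next
    assume unsolvable: "\<not> post_solvable Q w z"
    show "inj_on (list_product M) {ws. ws \<noteq> [] \<and> set ws \<subseteq> \<gamma> ` ?A}"
    proof (rule inj_onI)
      fix vs ws assume "vs \<in> {ws. ws \<noteq> [] \<and> set ws \<subseteq> \<gamma> ` ?A}" "ws \<in> {ws. ws \<noteq> [] \<and> set ws \<subseteq> \<gamma> ` ?A}"
        and eq: "list_product M vs = list_product M ws"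
      then have "vs \<in> lists (\<gamma> ` ?A)" "ws \<in> lists (\<gamma> ` ?A)"
        by (simp_all add: lists_eq_set)
      then obtain xs ys where xy: "vs = map \<gamma> xs" "xs \<in> lists ?A" "ws = map \<gamma> ys" "ys \<in> lists ?A"
        unfolding lists_image by (elim imageE)
      then have A: "set xs \<subseteq> ?A" "set ys \<subseteq> ?A"
        by (simp_all only: lists_eq_set mem_Collect_eq)
      have "\<phi> (block_code f (map fst xs), block_code g (concat (map (piece w z) xs)))
          = \<phi> (block_code f (map fst ys), block_code g (concat (map (piece w z) ys)))"
        using eq xy(1,3) by (simp only: prod)
      from eqD[OF this A] have eqs: "map fst xs = map fst ys"
        "concat (map (piece w z) xs) = concat (map (piece w z) ys)"
        by blast+
      have "fst ` set xs \<subseteq> tiles Q"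
        using A(1) by auto
      with post_solvable_if_ambiguous[OF nonempty eqs(1) _ eqs(2)] unsolvable have "xs = ys"
        by blast
      with xy show "vs = ws"
        by simp
    qed
  qed
qed

end

section \<open>Numbering of programs and the diagonal argument\<close>

definition decode_instr :: "nat \<Rightarrow> instr" where
  "decode_instr d = [NOP, RIGHT, INCR, TEST, OPEN, CLOSE, FAILS] ! d"

text \<open>
  The base 7 digits of \<open>x\<close>, padded with leading zeros, that is with \<open>NOP\<close>, to the length \<open>x\<close>. Hence \<open>x\<close>
  also bounds the registers used by the program.
\<close>

definition program :: "nat \<Rightarrow> instr list" where
  "program x = map (\<lambda>i. decode_instr (x div 7 ^ i mod 7)) (rev [0..<x])"

text \<open>\<open>NOP\<close> is the digit 0, so the instructions of \<open>p\<close> have nonzero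
  digits and the numeral of \<open>p\<close> is at least its length.\<close>

lemma program_surj:
  assumes "NOP \<notin> set p"
  obtains x k where "program x = replicate k NOP @ p" "length p \<le> x"
proof -
  \<comment> \<open>The number \<open>m\<close> of digits read is decoupled from \<open>x\<close>:
    appending an instruction turns \<open>x\<close> into \<open>7 * x + d\<close>, but
    \<open>m\<close> only grows by one.\<close>
  have digits: "\<exists>x. length p \<le> x \<and> (\<forall>m\<ge>length p.
      map (\<lambda>i. decode_instr (x div 7 ^ i mod 7)) (rev [0..<m]) = replicate (m - length p) NOP @ p)"
    using assms
  proof (induction p rule: rev_induct)
    case Nil
    show ?case
      by (intro exI[of _ 0]) (auto simp: decode_instr_def map_replicate_const)
  next
    case (snoc j p)
    then obtain x where x: "length p \<le> x" "\<And>m. length p \<le> m \<Longrightarrow>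
      map (\<lambda>i. decode_instr (x div 7 ^ i mod 7)) (rev [0..<m]) = replicate (m - length p) NOP @ p"
      by auto
    obtain d where d: "0 < d" "d < 7" "decode_instr d = j"
    proof -
      have "decode_instr 1 = RIGHT" "decode_instr 2 = INCR" "decode_instr 3 = TEST"
        "decode_instr 4 = OPEN" "decode_instr 5 = CLOSE" "decode_instr 6 = FAILS"
        by (simp_all add: decode_instr_def)
      then show ?thesis
        using that[of 1] that[of 2] that[of 3] that[of 4] that[of 5] that[of 6] snoc.prems
        by (cases j) auto
    qed
    let ?x = "7 * x + d"
    have "map (\<lambda>i. decode_instr (?x div 7 ^ i mod 7)) (rev [0..<m]) = replicate (m - length (p @ [j])) NOP @ p @ [j]"
      if "length (p @ [j]) \<le> m" for m
    proof -
      from that obtain m' where m: "m = Suc m'" "length p \<le> m'"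
        by (cases m) auto
      have "rev [0..<m] = map Suc (rev [0..<m']) @ [0]"
        by (simp add: m upt_rec[of 0 "Suc m'"] map_Suc_upt rev_map[symmetric] del: upt_Suc)
      moreover have "?x div 7 ^ Suc i mod 7 = x div 7 ^ i mod 7" for i
        using d by (simp add: div_mult2_eq)
      moreover have "?x mod 7 = d"
        using d by simp
      ultimately show ?thesis
        using x(2)[OF m(2)] d m by (simp add: comp_def)
    qed
    moreover have "length (p @ [j]) \<le> ?x"
      using x(1) d by simp
    ultimately show ?case
      by blast
  qed
  then obtain x where "length p \<le> x" "program x = replicate (x - length p) NOP @ p"
    unfolding program_def by blast
  then show thesis
    by (rule that[rotated])
qed

text \<open>Register 0 holds \<open>x\<close>, so the program numbered \<open>x\<close> receives its
  own number; registers 1 to \<open>x\<close> start at zero.\<close>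

definition initial_word :: "nat \<Rightarrow> sym list" where
  "initial_word x = [LEnd, Run] @ map Ins (program x) @ [Bound, Head] @ replicate x One @ replicate x Cell @ [REnd]"

lemma initial_word_eq:
  "initial_word x = LEnd # Run # map Ins (program x) @ Bound # tape 0 (\<lambda>i. if i = 0 then x else 0) (Suc x)"
proof -
  let ?s = "\<lambda>i :: nat. if i = 0 then x else 0"
  have "Cell # replicate (?s i) One = [Cell]" if "i \<in> set [Suc 0..<Suc x]" for i
  proof -
    have "i \<noteq> 0"
      using that by (auto simp only: set_upt atLeastLessThan_iff)
    then show ?thesis by simp
  qed
  then have "map (\<lambda>i. Cell # replicate (?s i) One) [Suc 0..<Suc x] = map (\<lambda>i. [Cell]) [Suc 0..<Suc x]"
    by (rule map_cong[OF refl])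
  then have "cells ?s (Suc 0) (Suc x) = replicate x Cell"
    by (simp add: cells_def concat_map_singleton map_replicate_const del: upt_Suc)
  then show ?thesis
    by (simp add: initial_word_def tape_def cells_empty)
qed

lemma foldable_initial_word: "foldable initial_word"
proof -
  have "foldable program"
    using foldable_map[OF foldable_digits[of 7], of decode_instr] by (simp add: program_def[abs_def] comp_def)
  then show ?thesis
    unfolding initial_word_def[abs_def]
    by (intro foldable_append foldable_map foldable_replicate foldable_const)
qed

lemma regs_below_mono: "regs_below m c \<Longrightarrow> m \<le> n \<Longrightarrow> regs_below n c"
  by (induction c) auto

text \<open>Registers are addressed in unary: an access to register \<open>i\<close> takes
  \<open>i\<close> letters \<open>RIGHT\<close> and at least one more instruction.\<close>

lemma regs_below_length: "regs_below (length (flatten c)) c"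
  by (induction c) (auto intro: regs_below_mono)

lemma NOP_notin_flatten: "NOP \<notin> set (flatten c)"
  by (induction c) auto

text \<open>A program computing this function, made to fail on the value 1, would halt on its own code iff it
  does not.\<close>

lemma Halt_not_computable:
  "\<not> computable1 (\<lambda>x. of_bool (srs rules (initial_word x) [Halt]))"
proof
  assume "computable1 (\<lambda>x. of_bool (srs rules (initial_word x) [Halt]))"
  then obtain r where "\<And>xs. length xs = Suc 0 \<Longrightarrow>
      rec_eval r xs (of_bool (srs rules (initial_word (xs ! 0)) [Halt]))"
    by (auto simp: computable_def)
  from this[of "[_]"] have r: "rec_eval r [x] (of_bool (srs rules (initial_word x) [Halt]))" for x
    by simp
  define c where "c = compile r [0] 1 2"
  let ?p = "flatten (SEQ c (LOOP 1 FAIL))"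
  obtain x k where x: "program x = replicate k NOP @ ?p" "length ?p \<le> x"
    using program_surj[OF NOP_notin_flatten] by blast
  let ?s = "\<lambda>i::nat. if i = 0 then x else 0"
  have "computes c ?s 1 2 (of_bool (srs rules (initial_word x) [Halt]))"
    unfolding c_def by (rule compile_correct) (use r in auto)
  then obtain s' where s': "exec c ?s s'" "s' 1 = of_bool (srs rules (initial_word x) [Halt])"
    by (auto simp: computes_def)
  have "regs_below (Suc x) c" "1 < Suc x"
    using regs_below_mono[OF regs_below_length, of c "Suc x"] x(2) by auto
  from run_program_Halt_iff[OF s'(1) this, of k]
  have "srs rules (initial_word x) [Halt] \<longleftrightarrow> s' 1 = 0"
    unfolding initial_word_eq x(1) .
  with s'(2) show False
    by (cases "s' 1 = 0") simp_all
qed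

section \<open>Reduction of reachability to bounded freeness\<close>

lemma finite_rules: "finite rules"
proof (rule finite_subset)
  let ?L = "{xs :: sym list. set xs \<subseteq> UNIV \<and> length xs \<le> 3}"
  show "rules \<subseteq> ?L \<times> ?L"
    using rules_length by auto
  show "finite (?L \<times> ?L)"
    by (intro finite_cartesian_product finite_lists_length_le) simp_all
qed

text \<open>The rules are fixed, hence so is the number of pairs of a tile and a Boolean, which
  serves as \<open>K\<close>. Only the generator for \<open>(Start, True)\<close> varies with
  \<open>x\<close>, so the code of the set is one power of two plus a constant.\<close>

lemma (in word_pair_embedding) bounded_freeness_undecidable:
  assumes enc: "inj_on enc (carrier M)"
    and comp: "\<And>a W. foldable W \<Longrightarrow> computable1 (\<lambda>x. enc (\<phi> (a, W x)))"
  shows "\<exists>K. \<not> bounded_freeness_decidable M enc K"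
proof -
  define Q where "Q = srs_pairs rules"
  define z where "z = map Some [Halt] @ [None]"
  define w where "w x = map Some (initial_word x) @ [None]" for x
  have nonempty: "\<forall>(l, r)\<in>Q. l \<noteq> [] \<and> r \<noteq> []"
    using rules_length by (fastforce simp: Q_def srs_pairs_def)
  have finite: "finite (tiles Q \<times> (UNIV :: bool set))"
    using finite_rules by (simp add: tiles_def Q_def srs_pairs_def)
  then obtain f :: "sym option tile \<Rightarrow> nat" where f: "inj_on f (tiles Q)"
    using finite_imp_inj_to_nat_seg[of "tiles Q"] by (auto simp: finite_cartesian_product_iff)
  obtain g :: "sym option letter \<Rightarrow> nat" where g: "inj g"
    using finite_imp_inj_to_nat_seg[OF finite_class.finite_UNIV] by blast
  define \<gamma> where "\<gamma> x k = \<phi> (block_code f [fst k], block_code g (piece (w x) z k))" for x k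
  define S where "S x = \<gamma> x ` (tiles Q \<times> UNIV)" for x
  have inj: "inj_on (\<gamma> x) (tiles Q \<times> UNIV)"
    and free: "free_over M (S x) \<longleftrightarrow> \<not> post_solvable Q (w x) z" for x
    unfolding S_def \<gamma>_def[abs_def] using free_over_tiles[OF nonempty f g] by blast+
  let ?k = "(Start, True)" and ?B = "tiles Q \<times> UNIV - {(Start, True)}"
  have k: "tiles Q \<times> UNIV = insert ?k ?B"
    by (auto simp: tiles_def)
  have \<gamma>_0: "\<gamma> x k = \<gamma> 0 k" if "k \<noteq> ?k" for x k
    unfolding \<gamma>_def using that by (cases "(w x, z, k)" rule: piece.cases) auto
  have B: "\<gamma> x ` ?B = \<gamma> 0 ` ?B" for x
    by (rule image_cong[OF refl \<gamma>_0]) blast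
  have S: "S x = insert (\<gamma> x ?k) (\<gamma> 0 ` ?B)" for x
    unfolding S_def by (subst k) (simp only: image_insert B[of x])
  have carrier: "S x \<subseteq> carrier M" for x
    using closed by (auto simp: S_def \<gamma>_def)
  have "finset_code enc (S x) = 2 ^ enc (\<gamma> x ?k) + finset_code enc (\<gamma> 0 ` ?B)" for x
  proof -
    \<comment> \<open>The power of two may be added because the varying generator is not among the
      fixed ones.\<close>
    have "inj_on (\<gamma> x) (insert ?k ?B)"
      using subst[OF k, of "inj_on (\<gamma> x)"] inj by blast
    then have "\<gamma> x ?k \<notin> \<gamma> x ` ?B"
      unfolding inj_on_insert by simp
    then have "\<gamma> x ?k \<notin> \<gamma> 0 ` ?B"
      by (simp only: B[of x] not_False_eq_True)
    then have "enc (\<gamma> x ?k) \<notin> enc ` \<gamma> 0 ` ?B"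
      using carrier[of x] S[of x] by (auto dest!: inj_onD[OF enc])
    then show ?thesis
      unfolding finset_code_def S using finite by (simp add: set_encode_insert)
  qed
  moreover have "computable1 (\<lambda>x. enc (\<gamma> x ?k))"
  proof -
    have "foldable w"
      unfolding w_def[abs_def] by (intro foldable_append foldable_map foldable_initial_word foldable_const)
    then have "foldable (\<lambda>x. [Beg, Hash] @ concat (map (\<lambda>a. [Ltr a, Hash]) (w x)))"
      by (intro foldable_append foldable_concat_map foldable_const)
    then have "foldable (\<lambda>x. block_code g (piece (w x) z ?k))"
      unfolding block_code_def by (intro foldable_concat_map) (simp add: hash_after_def)
    then show ?thesis
      unfolding \<gamma>_def by (rule comp)
  qed
  ultimately have code: "computable1 (\<lambda>x. finset_code enc (S x))"
    by (simp add: computable_add computable_const computable1_comp[OF computable1_power2])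
  have "\<not> bounded_freeness_decidable M enc (card (tiles Q \<times> (UNIV :: bool set)))"
  proof
    assume "bounded_freeness_decidable M enc (card (tiles Q \<times> (UNIV :: bool set)))"
    moreover have "S x \<in> {S \<in> Fpow (carrier M). card S \<le> card (tiles Q \<times> (UNIV :: bool set))}" for x
      using finite carrier by (simp add: S_def Fpow_def card_image_le)
    ultimately obtain r where r: "rec_eval r [finset_code enc (S x)] (if free_over M (S x) then 1 else 0)" for x
      unfolding bounded_freeness_decidable_def decidable_on_def by meson
    from code obtain rs where "\<And>xs. length xs = Suc 0 \<Longrightarrow> rec_eval rs xs (finset_code enc (S (xs ! 0)))"
      unfolding computable_def by blast
    then have "rec_eval (Comp r [rs]) xs (if free_over M (S (xs ! 0)) then 1 else 0)"
      if "length xs = Suc 0" for xs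
      using that by (intro eval_Comp[OF _ r]) simp
    then have "computable1 (\<lambda>x. if free_over M (S x) then 1 else 0)"
      unfolding computable_def by blast
    \<comment> \<open>Freeness corresponds to unreachability, hence the complement.\<close>
    from computable1_comp[OF computable1_diff[of 1] this]
    have "computable1 (\<lambda>x. 1 - (if free_over M (S x) then 1 else 0))" .
    also have "(\<lambda>xs. 1 - (if free_over M (S (xs ! 0)) then 1 else 0))
        = (\<lambda>xs. of_bool (srs rules (initial_word (xs ! 0)) [Halt]) :: nat)"
      using srs_iff_post_solvable[of rules] by (auto simp: fun_eq_iff free Q_def w_def z_def)
    finally show False
      using Halt_not_computable by blast
  qed
  then show ?thesis ..
qed

section \<open>The three monoids\<close>

lemma freeness_undecidable_if_bounded:
  "\<exists>K. \<not> bounded_freeness_decidable M enc K \<Longrightarrow> \<not> freeness_decidable M enc"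
  unfolding freeness_decidable_def bounded_freeness_decidable_def decidable_on_def by blast

lemma list_encode_map: "list_encode (map f w) = foldr (\<lambda>a n. Suc (prod_encode (f a, n))) w 0"
  by (induction w) auto

lemma computable1_word_code: "foldable W \<Longrightarrow> computable1 (\<lambda>x. word_code e (W x))"
  unfolding word_code_def list_encode_map
  by (rule foldableD)
    (auto intro!: computable_Suc computable_prod_encode computable_const computable_nth)

lemma binary_words2_undecidable:
  "\<exists>K. \<not> bounded_freeness_decidable binary_words2 binary_words2_code K"
proof -
  interpret word_pair_embedding binary_words2 id
    by (rule word_pair_embedding.intro[OF monoid_binary_words2])
      (simp_all add: binary_words2_def free_monoid_def DirProd_def)
  show ?thesis
  proof (rule bounded_freeness_undecidable)
    show "inj_on binary_words2_code (carrier binary_words2)"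
      using inj_binary_words2_code by (rule inj_on_subset) simp
    show "computable1 (\<lambda>x. binary_words2_code (id (a, W x)))" if "foldable W" for a W
      unfolding binary_words2_code_def pair_code_def id_apply fst_conv snd_conv
      by (intro computable_prod_encode computable_const computable1_word_code that)
  qed
qed

lemma reduced_positive: "reduced (map (Pair False) w)"
  by (induction w) (auto simp: reduced_Cons letter_inv_def hd_map)

text \<open>In positive words no letter meets its inverse, so nothing cancels: the free monoid
  embeds in the free group.\<close>

lemma reduced_mult_positive:
  "reduced_mult (map (Pair False) v) (map (Pair False) w) = map (Pair False) (v @ w)"
  by (induction v) (auto simp: reduced_mult_def push_letter_reduced reduced_positive[of "_ # _", simplified]
      simp del: map_append simp flip: map_append)

lemma FG2_squared_undecidable:
  "\<exists>K. \<not> bounded_freeness_decidable FG2_squared FG2_squared_code K"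
proof -
  let ?pos = "map (Pair False) :: bool list \<Rightarrow> fg2"
  interpret word_pair_embedding FG2_squared "map_prod ?pos ?pos"
  proof (rule word_pair_embedding.intro)
    show "Group.monoid FG2_squared"
      using group_FG2_squared by (rule group.is_monoid)
    show "inj (map_prod ?pos ?pos)"
      by (intro prod.inj_map list.inj_map injI) auto
  qed (auto simp: FG2_squared_def FG2_def free_group_def DirProd_def reduced_positive
      reduced_mult_positive simp flip: map_append)
  show ?thesis
  proof (rule bounded_freeness_undecidable)
    show "inj_on FG2_squared_code (carrier FG2_squared)"
      using inj_FG2_squared_code by (rule inj_on_subset) simp
    show "computable1 (\<lambda>x. FG2_squared_code (map_prod ?pos ?pos (a, W x)))" if "foldable W" for a W
      unfolding FG2_squared_code_def FG2_code_def pair_code_def map_prod_simp fst_conv snd_conv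
      by (intro computable_prod_encode computable_const computable1_word_code foldable_map that)
  qed
qed

text \<open>Words are read as base 3 numerals with the digits 1 and 2, least significant digit first.\<close>

definition word_numeral :: "bool list \<Rightarrow> nat" where
  "word_numeral w = foldr (\<lambda>b n. (if b then 2 else 1) + (n + n + n)) w 0"

text \<open>This is \<open>3 ^ length w\<close>, written as a fold with additions so that
  \<open>foldableD\<close> and \<open>computable_add\<close> apply.\<close>

definition word_scale :: "bool list \<Rightarrow> nat" where
  "word_scale w = foldr (\<lambda>b n. n + n + n) w 1"

lemma word_scale_append: "word_scale (v @ w) = word_scale v * word_scale w"
  by (induction v) (auto simp: word_scale_def algebra_simps)

lemma word_numeral_append: "word_numeral (v @ w) = word_numeral v + word_scale v * word_numeral w"
  by (induction v) (auto simp: word_numeral_def word_scale_def algebra_simps)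

text \<open>The remainder modulo 3 reveals the first letter, and as no digit is 0, only the empty
  word has numeral 0.\<close>

lemma inj_word_numeral: "inj word_numeral"
proof (rule injI)
  fix v w show "word_numeral v = word_numeral w \<Longrightarrow> v = w"
  proof (induction v arbitrary: w)
    case Nil
    then show ?case by (cases w) (auto simp: word_numeral_def split: if_splits)
  next
    case (Cons b v)
    then obtain c w' where w: "w = c # w'"
      by (cases w) (auto simp: word_numeral_def split: if_splits)
    have eq: "(if b then 2 else 1) + 3 * word_numeral v = (if c then 2 else 1) + 3 * word_numeral w'"
      using Cons.prems by (simp add: w word_numeral_def)
    then have "b = c"
      by (cases b; cases c; simp; presburger)
    with eq Cons.IH[of w'] w show ?case
      by simp
  qed
qed

text \<open>By \<open>word_numeral_append\<close>, prefixing a word acts on numerals as an affine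
  map with factor \<open>word_scale\<close> and constant term \<open>word_numeral\<close>; rows 1
  and 2 hold one such map each and share the third row of homogeneous coordinates.\<close>

definition word_matrix :: "bool list \<times> bool list \<Rightarrow> nat ^ 3 ^ 3" where
  "word_matrix p = (\<chi> i j.
     if i = 1 \<and> j = 1 then word_scale (fst p) else if i = 1 \<and> j = 3 then word_numeral (fst p)
     else if i = 2 \<and> j = 2 then word_scale (snd p) else if i = 2 \<and> j = 3 then word_numeral (snd p)
     else if i = 3 \<and> j = 3 then 1 else 0)"

lemma nat_mat3_undecidable: "\<exists>K. \<not> bounded_freeness_decidable nat_mat3 nat_mat3_code K"
proof -
  interpret word_pair_embedding nat_mat3 word_matrix
  proof (rule word_pair_embedding.intro)
    show "Group.monoid nat_mat3"
      by (rule monoid_nat_mat3)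
    show "word_matrix ([], []) = \<one>\<^bsub>nat_mat3\<^esub>"
      by (auto simp: nat_mat3_def word_matrix_def vec_eq_iff forall_3 mat_def word_scale_def word_numeral_def)
    show "word_matrix (a @ c, b @ d) = word_matrix (a, b) \<otimes>\<^bsub>nat_mat3\<^esub> word_matrix (c, d)" for a b c d
      by (simp add: nat_mat3_def word_matrix_def vec_eq_iff forall_3 matrix_matrix_mult_def sum_3
          word_scale_append word_numeral_append)
    show "inj word_matrix"
    proof (rule injI)
      fix p q assume "word_matrix p = word_matrix q"
      then have "word_matrix p $ 1 $ 3 = word_matrix q $ 1 $ 3" "word_matrix p $ 2 $ 3 = word_matrix q $ 2 $ 3"
        by simp_all
      then show "p = q"
        by (auto simp: word_matrix_def prod_eq_iff inj_eq[OF inj_word_numeral])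
    qed
  qed (simp add: nat_mat3_def)
  show ?thesis
  proof (rule bounded_freeness_undecidable)
    show "inj_on nat_mat3_code (carrier nat_mat3)"
      using inj_nat_mat3_code by (rule inj_on_subset) simp
    show "computable1 (\<lambda>x. nat_mat3_code (word_matrix (a, W x)))" if "foldable W" for a W
    proof -
      have "computable1 (\<lambda>x. word_scale (W x))" "computable1 (\<lambda>x. word_numeral (W x))"
        unfolding word_scale_def word_numeral_def
        by (rule foldableD[OF that]; intro computable_add computable_const computable_nth; simp)+
      then show ?thesis
        unfolding nat_mat3_code_def
        by (simp add: word_matrix_def computable_list_encode_Cons computable_const
            del: list_encode.simps(2))
    qed
  qed
qed

theorem proposition3p4:
  shows "(\<not> freeness_decidable nat_mat3 nat_mat3_code
          \<and> (\<exists>K. \<not> bounded_freeness_decidable nat_mat3 nat_mat3_code K))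
       \<and> (\<not> freeness_decidable binary_words2 binary_words2_code
          \<and> (\<exists>K. \<not> bounded_freeness_decidable binary_words2 binary_words2_code K))
       \<and> (\<not> freeness_decidable FG2_squared FG2_squared_code
          \<and> (\<exists>K. \<not> bounded_freeness_decidable FG2_squared FG2_squared_code K))"
  by (intro conjI nat_mat3_undecidable binary_words2_undecidable FG2_squared_undecidable
      freeness_undecidable_if_bounded)

end
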